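(* Let $G$ be a loop-free simple undirected $\aleph_0$-regular Borel graph on a Borel space $X$ of vertices. If $\mu$ is any Borel probability measure on $X$, then there is an $E_G$-invariant $\mu$-conull Borel set $C_\mu\subseteq X$ and a symmetric Borel function $f_\mu:G\restriction C_\mu\to\mathbb{N}$ such that $f_\mu$ is domatic everywhere in $C_\mu$. Similarly, if $\tau$ is any Polish topology on $X$, then there is an $E_G$-invariant $\tau$-comeager Borel set $C_\tau\subseteq X$ and a symmetric Borel function $f_\tau:G\restriction C_\tau\to\mathbb{N}$ such that $f_\tau$ is domatic everywhere in $C_\tau$.
   Context: A Borel space means a standard Borel space; a Polish topology on $X$ means one generating its Borel structure. The Borel graph is a Borel set $G\subseteq X^2$ (the edge set), here symmetric and disjoint from the diagonal. $N_G(x)=\{y\in X:(x,y)\in G\}$, and $\aleph_0$-regular means $|N_G(x)|=\aleph_0$ for all $x\in X$. $E_G$ is the equivalence relation on $X$ of lying in the same connected component of $G$; a set is $E_G$-invariant if it is a union of connected components of $G$. For $C\subseteq X$, $G\restriction C=G\cap C^2$. A function $f:G\restriction C\to\mathbb{N}$ is symmetric if $f(v,w)=f(w,v)$ for every edge $(v,w)\in G\restriction C$. For $E_G$-invariant $C$, such an $f$ is domatic at $v\in C$ if for every $c\in\mathbb{N}$ there exists $w\in N_G(v)$ with $f(v,w)=f(w,v)=c$. *)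

theory Defs
  imports "HOL-Probability.Probability" "HOL-Library.Equipollence"
begin

text \<open>A Borel space is given by a \<^typ>\<open>'a measure\<close> \<open>X\<close>, of which only \<open>space X\<close> and \<open>sets X\<close>
  matter.  The Borel structure of \<open>X\<^sup>2\<close> is that of \<open>X \<Otimes>\<^sub>M X\<close>.\<close>

definition polish_topology :: "'a topology \<Rightarrow> bool" where
  "polish_topology T \<longleftrightarrow> completely_metrizable_space T \<and> separable_space T"

definition polish_topology_on :: "'a measure \<Rightarrow> 'a topology \<Rightarrow> bool" where
  "polish_topology_on X T \<longleftrightarrow>
     polish_topology T \<and> topspace T = space X \<and>
     sets X = sigma_sets (space X) {U. openin T U}"

definition standard_borel_space :: "'a measure \<Rightarrow> bool" where
  "standard_borel_space X \<longleftrightarrow> (\<exists>T. polish_topology_on X T)"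

definition nowhere_dense_in :: "'a topology \<Rightarrow> 'a set \<Rightarrow> bool" where
  "nowhere_dense_in T N \<longleftrightarrow> N \<subseteq> topspace T \<and> T interior_of (T closure_of N) = {}"

definition meager_in :: "'a topology \<Rightarrow> 'a set \<Rightarrow> bool" where
  "meager_in T A \<longleftrightarrow> (\<exists>\<N>. countable \<N> \<and> (\<forall>N\<in>\<N>. nowhere_dense_in T N) \<and> A = \<Union>\<N>)"

definition comeager_in :: "'a topology \<Rightarrow> 'a set \<Rightarrow> bool" where
  "comeager_in T C \<longleftrightarrow> C \<subseteq> topspace T \<and> meager_in T (topspace T - C)"

definition conull :: "'a measure \<Rightarrow> 'a set \<Rightarrow> bool" where
  "conull \<mu> C \<longleftrightarrow> C \<subseteq> space \<mu> \<and> space \<mu> - C \<in> null_sets \<mu>"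

definition borel_graph :: "'a measure \<Rightarrow> ('a \<times> 'a) set \<Rightarrow> bool" where
  "borel_graph X G \<longleftrightarrow> G \<in> sets (X \<Otimes>\<^sub>M X) \<and> sym G \<and> irrefl G"

definition nbhd :: "'a measure \<Rightarrow> ('a \<times> 'a) set \<Rightarrow> 'a \<Rightarrow> 'a set" where
  "nbhd X G x = {y \<in> space X. (x, y) \<in> G}"

definition aleph0_regular :: "'a measure \<Rightarrow> ('a \<times> 'a) set \<Rightarrow> bool" where
  "aleph0_regular X G \<longleftrightarrow> (\<forall>x \<in> space X. nbhd X G x \<approx> (UNIV :: nat set))"

definition conn_rel :: "'a measure \<Rightarrow> ('a \<times> 'a) set \<Rightarrow> ('a \<times> 'a) set" where
  "conn_rel X G = {(x, y) \<in> space X \<times> space X. (x, y) \<in> G\<^sup>*}"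

definition invariant_set :: "'a measure \<Rightarrow> ('a \<times> 'a) set \<Rightarrow> 'a set \<Rightarrow> bool" where
  "invariant_set X G C \<longleftrightarrow> (\<exists>\<K> \<subseteq> space X // conn_rel X G. C = \<Union>\<K>)"

definition graph_restrict :: "('a \<times> 'a) set \<Rightarrow> 'a set \<Rightarrow> ('a \<times> 'a) set" where
  "graph_restrict G C = G \<inter> C \<times> C"

text \<open>Edge labellings are total functions on pairs of which only the values on
  \<open>graph_restrict G C\<close> are relevant.\<close>

definition borel_labelling ::
  "'a measure \<Rightarrow> ('a \<times> 'a) set \<Rightarrow> 'a set \<Rightarrow> ('a \<times> 'a \<Rightarrow> nat) \<Rightarrow> bool" where
  "borel_labelling X G C f \<longleftrightarrow>
     f \<in> restrict_space (X \<Otimes>\<^sub>M X) (graph_restrict G C) \<rightarrow>\<^sub>M count_space UNIV"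

definition symmetric_labelling :: "('a \<times> 'a) set \<Rightarrow> 'a set \<Rightarrow> ('a \<times> 'a \<Rightarrow> nat) \<Rightarrow> bool" where
  "symmetric_labelling G C f \<longleftrightarrow> (\<forall>(v, w) \<in> graph_restrict G C. f (v, w) = f (w, v))"

text \<open>Intended for \<open>v\<close> in an invariant set, so that \<open>f\<close> is meaningful on all edges at \<open>v\<close>.\<close>

definition domatic_at ::
  "'a measure \<Rightarrow> ('a \<times> 'a) set \<Rightarrow> ('a \<times> 'a \<Rightarrow> nat) \<Rightarrow> 'a \<Rightarrow> bool" where
  "domatic_at X G f v \<longleftrightarrow> (\<forall>c. \<exists>w \<in> nbhd X G v. f (v, w) = c \<and> f (w, v) = c)"

end

theory Submission
  imports Defs
begin

text \<open>
  Colour the edges of \<open>G\<close> symmetrically with natural numbers, in a Borel way, so that every vertex sees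
  infinitely many colours.  For a sufficiently generic map \<open>p\<close> from colours to labels, the labels
  \<open>p (col (v, w))\<close> exhaust all natural numbers not only at almost every vertex \<open>x\<close> but, since there are
  only countably many codes of finite walks, at the endpoint of every walk from almost every \<open>x\<close>.
  The set of such \<open>x\<close> is invariant.  A suitable \<open>p\<close> is built directly in finite blocks, which
  avoids the theorems of Fubini and Kuratowski--Ulam and treats measure and category alike:
  all that is needed is that countably many largeness tests can be passed by a member of every increasing
  Borel exhaustion of \<open>X\<close>.

  The colouring, and the Borel measurability of everything defined by quantifying over neighbours,
  come from the Lusin--Novikov theorem: a continuous countable-to-one map on a Borel set is injective
  on each piece of some countable Borel cover.
\<close>

section \<open>Borel sets as injective images of closed sets\<close>

text \<open>The measure and the topology are arbitrary, so the union of all components meeting a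
  null (meager) set need not be null (meager). A labelling that is good almost everywhere can
  therefore not be repaired in general by discarding components. This is why every requirement is
  imposed at a starting vertex \<open>x\<close> and speaks of the end of a coded walk: for each code
  and each label \<open>k\<close>, the end of the walk, if there is one, sees a colour with label
  \<open>k\<close>. Infinitely many colours can serve \<open>x\<close> for a given code, so the sets
  of vertices served by longer and longer finite blocks of colours exhaust \<open>X\<close>. Being
  conull or comeager is not a property that some member of an exhaustion must have. It is split into
  countably many tests that do have this feature: measure above \<open>1 - 1 / (i + 1)\<close>, or
  being nonmeager in the \<open>i\<close>-th member of a countable pi-base.\<close>

type_synonym baire = "nat \<Rightarrow> nat"

section \<open>Topology of Baire space\<close>

lemma open_coordinate: "open {z :: baire. z i \<in> A}" and closed_coordinate: "closed {z :: baire. z i \<in> A}"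
proof -
  have *: "{z :: baire. z i \<in> B} = (\<lambda>z. z i) -` B" for B
    by auto
  show "open {z :: baire. z i \<in> A}"
    unfolding * by (intro open_vimage continuous_on_product_coordinates discrete_topology_class.open_discrete)
  show "closed {z :: baire. z i \<in> A}"
    unfolding * by (intro closed_vimage continuous_on_product_coordinates)
      (simp add: closed_def discrete_topology_class.open_discrete)
qed

lemma open_cylinder:
  fixes U :: "baire set"
  assumes "open U" "z \<in> U"
  obtains n where "\<And>w. (\<And>i. i < n \<Longrightarrow> w i = z i) \<Longrightarrow> w \<in> U"
proof -
  have "openin (product_topology (\<lambda>_. euclidean) UNIV) U"
    using assms(1) by (simp add: open_fun_def)
  from product_topology_open_contains_basis[OF this assms(2)]
  obtain X where X: "z \<in> Pi\<^sub>E UNIV X" "finite {i :: nat. X i \<noteq> (UNIV :: nat set)}" "Pi\<^sub>E UNIV X \<subseteq> U"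
    by auto
  obtain n where n: "\<And>i. X i \<noteq> UNIV \<Longrightarrow> i < n"
    using finite_nat_set_iff_bounded[THEN iffD1, OF X(2)] by auto
  have "w \<in> U" if "\<And>i. i < n \<Longrightarrow> w i = z i" for w
  proof -
    have "w i \<in> X i" for i
      using n[of i] that[of i] X(1) by (cases "X i = UNIV") (auto simp: PiE_iff)
    then show ?thesis
      using X(3) by (auto simp: PiE_iff)
  qed
  then show thesis ..
qed

text \<open>This is how limits of the branch constructions below enter a closed domain: each finite
  prefix only has to be realised in \<open>F\<close>.\<close>

lemma closed_cylinder:
  fixes F :: "baire set"
  assumes "closed F" "\<And>n. \<exists>w\<in>F. \<forall>i<n. w i = z i"
  shows "z \<in> F"
proof (rule ccontr)
  assume "z \<notin> F"
  with assms(1) obtain n where "\<And>w. (\<And>i. i < n \<Longrightarrow> w i = z i) \<Longrightarrow> w \<in> - F"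
    using open_cylinder[of "- F" z] by (auto simp: open_Compl)
  with assms(2)[of n] show False
    by auto
qed

lemma continuous_on_cylinder:
  fixes g :: "baire \<Rightarrow> 'a :: topological_space"
  assumes "continuous_on F g" "z \<in> F" "open U" "g z \<in> U"
  obtains n where "\<And>w. w \<in> F \<Longrightarrow> (\<And>i. i < n \<Longrightarrow> w i = z i) \<Longrightarrow> g w \<in> U"
proof -
  obtain A where A: "open A" "A \<inter> F = g -` U \<inter> F"
    using assms(1,3) by (auto simp: continuous_on_open_invariant)
  with assms obtain n where "\<And>w. (\<And>i. i < n \<Longrightarrow> w i = z i) \<Longrightarrow> w \<in> A"
    using open_cylinder[of A z] by blast
  with A(2) show thesis
    by (intro that[of n]) blast
qed

lemma closed_Collect_eq_on_baire:
  fixes f g :: "'a :: topological_space \<Rightarrow> baire"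
  assumes "closed E" "continuous_on E f" "continuous_on E g"
  shows "closed {z \<in> E. f z = g z}"
proof -
  have "continuous_on E (\<lambda>z. (f z i, g z i))" for i
    by (rule continuous_on_Pair[OF continuous_on_product_then_coordinatewise[OF assms(2)]
          continuous_on_product_then_coordinatewise[OF assms(3)]])
  then have "closed (E \<inter> (\<lambda>z. (f z i, g z i)) -` {y. \<exists>x. y = (x, x)})" for i
    by (rule continuous_closed_preimage) (rule assms(1) closed_diagonal)+
  then have "closed (E \<inter> (\<Inter>i. E \<inter> (\<lambda>z. (f z i, g z i)) -` {y. \<exists>x. y = (x, x)}))"
    using assms by (intro closed_Int closed_INT) auto
  also have "E \<inter> (\<Inter>i. E \<inter> (\<lambda>z. (f z i, g z i)) -` {y. \<exists>x. y = (x, x)}) = {z \<in> E. f z = g z}"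
    by (auto simp: fun_eq_iff)
  finally show ?thesis .
qed

text \<open>These generators are clopen and their complements are again generators, a convenient
  start for an induction that treats a set together with its complement.\<close>

lemma sets_borel_baire:
  "sets (borel :: baire measure) = sigma_sets UNIV {{z. z i \<in> A} | i A. True}"
proof -
  have "sets (borel :: baire measure) = sets (Pi\<^sub>M UNIV (\<lambda>_. borel :: nat measure))"
    by (rule sets_PiM_equal_borel[symmetric])
  then show ?thesis
    by (simp add: sets_PiM_single sets_borel_eq_count_space)
qed

text \<open>The flag \<open>b\<close> distinguishes bijective codings, which exist for all Borel sets, from
  arbitrary ones, which define the analytic sets.\<close>

definition closed_image :: "bool \<Rightarrow> baire set \<Rightarrow> bool" where
  "closed_image b A \<longleftrightarrow>
     (\<exists>F (g :: baire \<Rightarrow> baire). closed F \<and> continuous_on F g \<and> (b \<longrightarrow> inj_on g F) \<and> g ` F = A)"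

abbreviation "analytic \<equiv> closed_image False"

lemma closed_imageI:
  "closed F \<Longrightarrow> continuous_on F g \<Longrightarrow> (b \<Longrightarrow> inj_on g F) \<Longrightarrow> closed_image b (g ` (F :: baire set))"
  unfolding closed_image_def by blast

lemma closed_image_closed: "closed A \<Longrightarrow> closed_image b (A :: baire set)"
  using closed_imageI[of A id b] by simp

lemma closed_image_image:
  assumes "closed_image b A" "continuous_on A f" "b \<Longrightarrow> inj_on f A"
  shows "closed_image b (f ` A)"
proof -
  obtain F and g :: "baire \<Rightarrow> baire" where *: "closed F" "continuous_on F g" "b \<longrightarrow> inj_on g F" "g ` F = A"
    using assms(1) unfolding closed_image_def by blast
  have "closed_image b ((f \<circ> g) ` F)"
    using * assms(2,3) by (intro closed_imageI continuous_on_compose comp_inj_on) auto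
  then show ?thesis
    unfolding image_comp[symmetric] *(4) .
qed

text \<open>Coordinates of the homeomorphism of Baire space with its countable power, used to pack
  countably many codes into one.\<close>

definition slice :: "nat \<Rightarrow> baire \<Rightarrow> baire" where
  "slice n z = (\<lambda>k. z (prod_encode (n, k)))"

lemma continuous_on_slice: "continuous_on S (slice n)"
  unfolding slice_def
  by (intro continuous_on_coordinatewise_then_product continuous_on_subset[OF continuous_on_product_coordinates]) auto

lemma slice_combine: "slice n (\<lambda>m. w (fst (prod_decode m)) (snd (prod_decode m))) = w n"
  by (simp add: slice_def)

lemma slice_eqI: "(\<And>n. slice n z = slice n w) \<Longrightarrow> z = w"
  unfolding slice_def by (metis (no_types, lifting) ext prod_decode_inverse surj_pair)

text \<open>The domain is the fibre product of the given codings: all sequences whose slices have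
  the same image under the respective maps. A common value determines each slice as soon as each
  \<open>g n\<close> is injective, so the bijective version is preserved.\<close>

lemma closed_image_INT:
  fixes A :: "nat \<Rightarrow> baire set"
  assumes "\<And>n. closed_image b (A n)"
  shows "closed_image b (\<Inter>n. A n)"
proof -
  obtain F and g :: "nat \<Rightarrow> baire \<Rightarrow> baire" where
    F: "\<And>n. closed (F n)" and g: "\<And>n. continuous_on (F n) (g n)" "\<And>n. b \<Longrightarrow> inj_on (g n) (F n)"
    "\<And>n. g n ` F n = A n"
    using assms unfolding closed_image_def by metis
  define E where "E = {z. \<forall>n. slice n z \<in> F n}"
  have "E = (\<Inter>n. slice n -` F n)"
    by (auto simp: E_def)
  then have E: "closed E"
    using F by (auto intro!: closed_INT closed_vimage continuous_on_slice)
  have cont: "continuous_on E (\<lambda>z. g n (slice n z))" for n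
    by (rule continuous_on_compose2[OF g(1) continuous_on_slice]) (auto simp: E_def)
  define H where "H = {z \<in> E. \<forall>n. g n (slice n z) = g 0 (slice 0 z)}"
  have "closed {z \<in> E. g n (slice n z) = g 0 (slice 0 z)}" for n
    by (rule closed_Collect_eq_on_baire[OF E cont cont])
  moreover have "H = (\<Inter>n. {z \<in> E. g n (slice n z) = g 0 (slice 0 z)})"
    by (auto simp: H_def)
  ultimately have H: "closed H"
    by (auto intro: closed_INT)
  have "inj_on (\<lambda>z. g 0 (slice 0 z)) H" if b
  proof (rule inj_onI)
    fix z w assume "z \<in> H" "w \<in> H" and eq: "g 0 (slice 0 z) = g 0 (slice 0 w)"
    define x where "x = g 0 (slice 0 w)"
    have "g n (slice n z) = x" "g n (slice n w) = x" "slice n z \<in> F n" "slice n w \<in> F n" for n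
      using \<open>z \<in> H\<close> \<open>w \<in> H\<close> eq unfolding H_def E_def x_def by auto
    then have "g n (slice n z) = g n (slice n w)" "slice n z \<in> F n" "slice n w \<in> F n" for n
      by simp_all
    then have "slice n z = slice n w" for n
      by (rule inj_onD[OF g(2)[OF that]])
    then show "z = w"
      by (rule slice_eqI)
  qed
  moreover have "(\<lambda>z. g 0 (slice 0 z)) ` H = (\<Inter>n. A n)"
  proof (intro equalityI subsetI)
    fix x assume "x \<in> (\<lambda>z. g 0 (slice 0 z)) ` H"
    then obtain z where "z \<in> H" "x = g 0 (slice 0 z)" by auto
    then have "g n (slice n z) = x" "slice n z \<in> F n" for n
      unfolding H_def E_def by auto
    then have "x \<in> g n ` F n" for n
      by (intro image_eqI[of x "g n" "slice n z"]) simp_all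
    then show "x \<in> (\<Inter>n. A n)"
      by (simp add: g(3))
  next
    fix x assume x: "x \<in> (\<Inter>n. A n)"
    have "\<exists>w\<in>F n. g n w = x" for n
    proof -
      have "x \<in> g n ` F n"
        using x by (simp add: g(3))
      then show ?thesis
        by blast
    qed
    then obtain w where w: "\<And>n. w n \<in> F n" "\<And>n. g n (w n) = x" by metis
    let ?z = "\<lambda>m. w (fst (prod_decode m)) (snd (prod_decode m))"
    have "?z \<in> H"
      using w by (auto simp: H_def E_def slice_combine)
    then show "x \<in> (\<lambda>z. g 0 (slice 0 z)) ` H"
      using w by (intro image_eqI[of _ _ ?z]) (auto simp: slice_combine)
  qed
  ultimately show ?thesis
    using H cont[of 0] closed_imageI[of H "\<lambda>z. g 0 (slice 0 z)" b]
    by (auto intro: continuous_on_subset simp: H_def)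
qed

lemma closed_image_Int:
  fixes A B :: "baire set"
  assumes "closed_image b A" "closed_image b B"
  shows "closed_image b (A \<inter> B)"
proof -
  have "closed_image b (\<Inter>n::nat. if n = 0 then A else B)"
    by (rule closed_image_INT) (use assms in auto)
  also have "(\<Inter>n::nat. if n = 0 then A else B) = A \<inter> B"
    by (auto split: if_splits)
  finally show ?thesis .
qed

text \<open>The domain is the disjoint sum of the given ones, with the first digit naming the
  summand. Disjointness of the images makes this digit recoverable from the value.\<close>

lemma closed_image_UN:
  fixes A :: "nat \<Rightarrow> baire set"
  assumes "\<And>n. closed_image b (A n)" "b \<Longrightarrow> disjoint_family A"
  shows "closed_image b (\<Union>n. A n)"
proof -
  obtain F and g :: "nat \<Rightarrow> baire \<Rightarrow> baire" where
    F: "\<And>n. closed (F n)" and g: "\<And>n. continuous_on (F n) (g n)" "\<And>n. b \<Longrightarrow> inj_on (g n) (F n)"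
    "\<And>n. g n ` F n = A n"
    using assms(1) unfolding closed_image_def by metis
  define tail :: "baire \<Rightarrow> baire" where "tail z = (\<lambda>k. z (Suc k))" for z
  define H where "H = {z. tail z \<in> F (z 0)}"
  define f where "f z = g (z 0) (tail z)" for z
  have tail: "continuous_on S tail" for S
    unfolding tail_def
    by (intro continuous_on_coordinatewise_then_product continuous_on_subset[OF continuous_on_product_coordinates]) auto
  have HU: "H = - (\<Union>n. {z. z 0 \<in> {n}} \<inter> tail -` (- F n))"
    by (auto simp: H_def)
  have H: "closed H"
    unfolding HU using F
    by (intro closed_Compl open_UN ballI open_Int open_coordinate open_vimage tail open_Compl)
  \<comment> \<open>Continuity is local, and the sets with a fixed first digit are clopen.\<close>
  have cont: "continuous_on H f"
  proof -
    have "continuous_on (H \<inter> {z. z 0 \<in> {n}}) f" for n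
    proof -
      have "continuous_on (H \<inter> {z. z 0 \<in> {n}}) (\<lambda>z. g n (tail z))"
        by (rule continuous_on_compose2[OF g(1) tail]) (auto simp: H_def)
      then show ?thesis
        by (rule continuous_on_eq) (auto simp: f_def)
    qed
    then show ?thesis
      unfolding continuous_on_def
    proof (intro ballI)
      fix z assume a: "\<And>n. \<forall>x\<in>H \<inter> {z. z 0 \<in> {n}}. (f \<longlongrightarrow> f x) (at x within H \<inter> {z. z 0 \<in> {n}})" "z \<in> H"
      have "at z within H \<inter> {w. w 0 \<in> {z 0}} = at z within H"
        by (rule at_within_nhd[OF _ open_coordinate[of 0 "{z 0}"]]) auto
      moreover have "(f \<longlongrightarrow> f z) (at z within H \<inter> {w. w 0 \<in> {z 0}})"
        using a(1)[of "z 0"] a(2) by blast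
      ultimately show "(f \<longlongrightarrow> f z) (at z within H)"
        by metis
    qed
  qed
  have "inj_on f H" if b
  proof (rule inj_onI)
    fix z w assume zw: "z \<in> H" "w \<in> H" "f z = f w"
    have "f z \<in> g (z 0) ` F (z 0)" "f w \<in> g (w 0) ` F (w 0)"
      using zw(1,2) unfolding f_def H_def by blast+
    then have "f z \<in> A (z 0)" "f z \<in> A (w 0)"
      unfolding g(3) using zw(3) by simp_all
    then have "z 0 = w 0"
      using assms(2)[OF that] by (auto simp: disjoint_family_on_def)
    moreover from this have "tail z = tail w"
      using inj_onD[OF g(2)[OF that, of "w 0"]] zw unfolding f_def H_def by simp
    ultimately have "z k = w k" for k
      by (cases k) (auto simp: tail_def fun_eq_iff)
    then show "z = w" ..
  qed
  moreover have "f ` H = (\<Union>n. A n)"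
  proof (intro equalityI subsetI)
    fix x assume "x \<in> f ` H"
    then obtain z where "x = g (z 0) (tail z)" "tail z \<in> F (z 0)"
      unfolding f_def H_def by blast
    then have "x \<in> g (z 0) ` F (z 0)"
      by simp
    then show "x \<in> (\<Union>n. A n)"
      unfolding g(3) by blast
  next
    fix x assume "x \<in> (\<Union>n. A n)"
    then obtain n w where "w \<in> F n" "x = g n w"
      unfolding g(3)[symmetric] by blast
    then show "x \<in> f ` H"
      by (intro image_eqI[of _ _ "case_nat n w"]) (auto simp: f_def H_def tail_def)
  qed
  ultimately show ?thesis
    using closed_imageI[OF H cont] by auto
qed

text \<open>Complements are carried along in the induction, because closed images are only known to
  be stable under countable intersections and (disjoint) countable unions.\<close>

theorem borel_closed_image:
  fixes A :: "baire set"
  assumes "A \<in> sets borel"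
  shows "closed_image b A"
proof -
  have "A \<in> sigma_sets UNIV {{z. z i \<in> A} | i A. True}"
    using assms by (simp add: sets_borel_baire)
  then have "closed_image b A \<and> closed_image b (- A)"
  proof induction
    case (Basic a)
    then obtain i B where a: "a = {z. z i \<in> B}" by auto
    have "closed a" "closed {z :: baire. z i \<in> - B}"
      unfolding a by (rule closed_coordinate)+
    moreover have "- a = {z. z i \<in> - B}"
      using a by auto
    ultimately show ?case
      by (simp only: closed_image_closed)
  next
    case Empty
    show ?case by (auto intro: closed_image_closed)
  next
    case (Compl a)
    then show ?case by (simp add: Compl_eq_Diff_UNIV[symmetric])
  next
    case (Union a)
    \<comment> \<open>The part of \<open>a n\<close> outside all earlier sets, written as a
      countable intersection so that the hypotheses for the sets and for their complements both
      apply.\<close>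
    define c where "c n = (\<Inter>k. if k < n then - a k else a n)" for n :: nat
    have c_sub: "c n \<subseteq> a n" for n
      using INT_lower[of n UNIV "\<lambda>k. if k < n then - a k else a n"] by (simp add: c_def)
    have c_compl: "c n \<subseteq> - a m" if "m < n" for m n
      using INT_lower[of m UNIV "\<lambda>k. if k < n then - a k else a n"] that by (simp add: c_def)
    have "(\<Union>n. a n) \<subseteq> (\<Union>n. c n)"
    proof
      fix x assume "x \<in> (\<Union>n. a n)"
      then have ex: "\<exists>n. x \<in> a n" by auto
      then have "x \<in> c (LEAST n. x \<in> a n)"
        unfolding c_def by (auto dest: not_less_Least intro: LeastI)
      then show "x \<in> (\<Union>n. c n)" by blast
    qed
    then have "(\<Union>n. a n) = (\<Union>n. c n)"
      using c_sub by blast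
    moreover have "disjoint_family c"
      unfolding disjoint_family_on_def
    proof (intro ballI impI)
      fix m n :: nat assume "m \<noteq> n"
      then consider "m < n" | "n < m" by linarith
      then show "c m \<inter> c n = {}"
        by cases (use c_sub c_compl in blast)+
    qed
    moreover have "closed_image b (c n)" for n
      unfolding c_def by (rule closed_image_INT) (use Union in auto)
    ultimately have "closed_image b (\<Union>n. a n)"
      using closed_image_UN[of b c] by metis
    moreover have "closed_image b (\<Inter>n. - a n)"
      by (rule closed_image_INT) (use Union in auto)
    ultimately show ?case
      by (metis Compl_UN)
  qed
  then show ?thesis ..
qed

section \<open>Separation and injective images\<close>

text \<open>Stage \<open>n + 1\<close> changes only entry \<open>n\<close>, so entry
  \<open>i\<close> is final from stage \<open>i + 1\<close> on. The diagonal agrees with stage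
  \<open>n\<close> below \<open>n\<close>, which is all that \<open>P n\<close> looks at.\<close>

lemma dependent_branch:
  assumes "P 0 z0"
    and cong: "\<And>n z w. (\<And>i. i < n \<Longrightarrow> z i = w i) \<Longrightarrow> P n z \<Longrightarrow> P n w"
    and step: "\<And>n z. P n z \<Longrightarrow> \<exists>k. P (Suc n) (z(n := k))"
  shows "\<exists>z. \<forall>n. P n z"
proof -
  have "\<exists>f. \<forall>n. P n (f n) \<and> (\<exists>k. f (Suc n) = (f n)(n := k))"
    by (rule dependent_nat_choice) (use assms in blast)+
  then obtain f where f: "\<And>n. P n (f n)" "\<And>n. \<exists>k. f (Suc n) = (f n)(n := k)"
    by blast
  have diag: "f n i = f (Suc i) i" if "i < n" for n i
    using that
  proof (induction n)
    case (Suc n)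
    from f(2)[of n] obtain k where k: "f (Suc n) = (f n)(n := k)" ..
    show ?case
    proof (cases "i = n")
      case False
      then show ?thesis
        using Suc k by simp
    qed simp
  qed simp
  have "P n (\<lambda>i. f (Suc i) i)" for n
    by (rule cong[OF diag f(1)])
  then show ?thesis by blast
qed

definition borel_separated :: "baire set \<Rightarrow> baire set \<Rightarrow> bool" where
  "borel_separated A B \<longleftrightarrow> (\<exists>D\<in>sets borel. A \<subseteq> D \<and> D \<inter> B = {})"

text \<open>Used contrapositively: inseparable unions contain an inseparable pair of pieces, which
  extends a branch by one digit.\<close>

lemma borel_separated_UN:
  fixes A B :: "nat \<Rightarrow> baire set"
  assumes "\<And>i j. borel_separated (A i) (B j)"
  shows "borel_separated (\<Union>i. A i) (\<Union>j. B j)"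
proof -
  obtain D where D: "\<And>i j. D i j \<in> sets borel" "\<And>i j. A i \<subseteq> D i j" "\<And>i j. D i j \<inter> B j = {}"
    using assms unfolding borel_separated_def by metis
  have "(\<Union>i. \<Inter>j. D i j) \<in> sets borel"
    using D(1) by auto
  moreover have "(\<Union>i. A i) \<subseteq> (\<Union>i. \<Inter>j. D i j)"
    using D(2) by blast
  moreover have "(\<Union>i. \<Inter>j. D i j) \<inter> (\<Union>j. B j) = {}"
    using D(3) by blast
  ultimately show ?thesis
    unfolding borel_separated_def by blast
qed

lemma image_cylinder_UN:
  fixes z :: baire
  shows "f ` {x \<in> F. \<forall>i<n. x i = z i} = (\<Union>k. f ` {x \<in> F. \<forall>i<Suc n. x i = (z(n := k)) i})"
proof -
  have "{x \<in> F. \<forall>i<n. x i = z i} = (\<Union>k. {x \<in> F. \<forall>i<Suc n. x i = (z(n := k)) i})"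
    by (auto simp: less_Suc_eq)
  then show ?thesis
    by (simp only: image_UN)
qed

text \<open>Lusin's separation theorem: if the images were inseparable, one could find a branch in each of
  the two domains along which the images of all cylinders remain inseparable, but by continuity small
  cylinders are mapped into disjoint open sets.\<close>

theorem analytic_separation:
  assumes "analytic A" "analytic B" "A \<inter> B = {}"
  shows "borel_separated A B"
proof (rule ccontr)
  assume not_sep: "\<not> borel_separated A B"
  obtain F and f :: "baire \<Rightarrow> baire" where F: "closed F" "continuous_on F f" "f ` F = A"
    using assms(1) unfolding closed_image_def by blast
  obtain K and g :: "baire \<Rightarrow> baire" where K: "closed K" "continuous_on K g" "g ` K = B"
    using assms(2) unfolding closed_image_def by blast
  define X where "X n z = f ` {x \<in> F. \<forall>i<n. x i = z i}" for n and z :: baire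
  define Y where "Y n z = g ` {x \<in> K. \<forall>i<n. x i = z i}" for n and z :: baire
  \<comment> \<open>A single branch of pairs stands for one branch in each domain, so that both are
    extended simultaneously.\<close>
  define P where "P n z \<longleftrightarrow> \<not> borel_separated (X n (\<lambda>i. fst (z i))) (Y n (\<lambda>i. snd (z i)))"
    for n and z :: "nat \<Rightarrow> nat \<times> nat"
  have "\<exists>z. \<forall>n. P n z"
  proof (rule dependent_branch)
    show "P 0 undefined"
    using not_sep F(3) K(3) by (simp add: P_def X_def Y_def)
  show "P n w" if "\<And>i. i < n \<Longrightarrow> z i = w i" "P n z" for n z w
    using that by (simp add: P_def X_def Y_def)
  show "\<exists>k. P (Suc n) (z(n := k))" if "P n z" for n z
  proof (rule ccontr)
    assume no_ext: "\<nexists>k. P (Suc n) (z(n := k))"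
    have "borel_separated (X (Suc n) ((\<lambda>i. fst (z i))(n := i))) (Y (Suc n) ((\<lambda>i. snd (z i))(n := j)))" for i j
    proof -
      have "(\<lambda>k. fst ((z(n := (i, j))) k)) = (\<lambda>i. fst (z i))(n := i)"
        "(\<lambda>k. snd ((z(n := (i, j))) k)) = (\<lambda>i. snd (z i))(n := j)"
        by auto
      moreover have "\<not> P (Suc n) (z(n := (i, j)))"
        using no_ext by blast
      ultimately show ?thesis
        unfolding P_def by simp
    qed
    then have "borel_separated (\<Union>i. X (Suc n) ((\<lambda>i. fst (z i))(n := i))) (\<Union>j. Y (Suc n) ((\<lambda>i. snd (z i))(n := j)))"
      by (rule borel_separated_UN)
    then have "borel_separated (X n (\<lambda>i. fst (z i))) (Y n (\<lambda>i. snd (z i)))"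
      unfolding X_def Y_def image_cylinder_UN[symmetric] .
    with that show False
      unfolding P_def by blast
  qed
  qed
  then obtain z where z: "\<And>n. P n z"
    by metis
  define a b where "a = (\<lambda>i. fst (z i))" and "b = (\<lambda>i. snd (z i))"
  have ns: "\<not> (D \<in> sets borel \<and> X n a \<subseteq> D \<and> D \<inter> Y n b = {})" for D n
    using z[of n] unfolding P_def borel_separated_def a_def b_def by blast
  \<comment> \<open>If \<open>X n a\<close> were empty, \<open>{}\<close> would separate it from
    \<open>Y n b\<close>; for \<open>b\<close> the whole space plays this role.\<close>
  have "a \<in> F"
  proof (rule closed_cylinder[OF F(1)])
    show "\<exists>w\<in>F. \<forall>i<n. w i = a i" for n
      using ns[of "{}" n] by (auto simp: X_def)
  qed
  moreover have "b \<in> K"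
  proof (rule closed_cylinder[OF K(1)])
    show "\<exists>w\<in>K. \<forall>i<n. w i = b i" for n
      using ns[of UNIV n] by (auto simp: Y_def)
  qed
  ultimately have "f a \<noteq> g b"
    using F(3) K(3) assms(3) by blast
  then obtain i where i: "f a i \<noteq> g b i"
    by blast
  obtain n where n: "\<And>w. w \<in> F \<Longrightarrow> (\<And>i. i < n \<Longrightarrow> w i = a i) \<Longrightarrow> f w \<in> {y. y i \<in> {f a i}}"
    using continuous_on_cylinder[OF F(2) \<open>a \<in> F\<close> open_coordinate[of i "{f a i}"]] by blast
  obtain m where m: "\<And>w. w \<in> K \<Longrightarrow> (\<And>i. i < m \<Longrightarrow> w i = b i) \<Longrightarrow> g w \<in> {y. y i \<in> {g b i}}"
    using continuous_on_cylinder[OF K(2) \<open>b \<in> K\<close> open_coordinate[of i "{g b i}"]] by blast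
  have "{y. y i \<in> {f a i}} \<in> sets (borel :: baire measure)"
    by (rule borel_open[OF open_coordinate])
  moreover have "X (max n m) a \<subseteq> {y. y i \<in> {f a i}}"
    using n unfolding X_def by auto
  moreover have "Y (max n m) b \<subseteq> {y. y i \<in> {g b i}}"
    using m unfolding Y_def by auto
  ultimately show False
    using ns[of "{y. y i \<in> {f a i}}" "max n m"] i by auto
qed

text \<open>Pairwise separators \<open>S i j\<close> need not be disjoint for different
  \<open>i\<close>. Subtracting \<open>S j i\<close> from \<open>S i j\<close> repairs this without
  losing \<open>A i\<close>, which is disjoint from \<open>S j i\<close>.\<close>

lemma analytic_separation_family:
  fixes A :: "nat \<Rightarrow> baire set"
  assumes "\<And>n. analytic (A n)" "disjoint_family A"
  shows "\<exists>D. (\<forall>n. D n \<in> sets borel) \<and> (\<forall>n. A n \<subseteq> D n) \<and> disjoint_family D"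
proof -
  have "\<exists>S. S \<in> sets borel \<and> A i \<subseteq> S \<and> S \<inter> A j = {}" if "i \<noteq> j" for i j
    using analytic_separation[OF assms(1,1), of i j] assms(2) that
    unfolding borel_separated_def disjoint_family_on_def by blast
  then obtain S where S: "\<And>i j. i \<noteq> j \<Longrightarrow> S i j \<in> sets borel"
      "\<And>i j. i \<noteq> j \<Longrightarrow> A i \<subseteq> S i j" "\<And>i j. i \<noteq> j \<Longrightarrow> S i j \<inter> A j = {}"
    by metis
  define D where "D i = (\<Inter>j. if j = i then UNIV else S i j - S j i)" for i
  have "D n \<in> sets borel" for n
    unfolding D_def by (rule sets.countable_INT) (use S(1) in auto)
  moreover have "A n \<subseteq> D n" for n
  proof
    fix x assume "x \<in> A n"
    then have "x \<in> (if j = n then UNIV else S n j - S j n)" for j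
      using S(2)[of n j] S(3)[of j n] by auto
    then show "x \<in> D n"
      unfolding D_def by blast
  qed
  moreover have "D i \<inter> D j = {}" if "i \<noteq> j" for i j
  proof -
    have "D i \<subseteq> S i j" "D j \<subseteq> - S i j"
      using that INT_lower[of j UNIV "\<lambda>j. if j = i then UNIV else S i j - S j i"]
        INT_lower[of i UNIV "\<lambda>i. if i = j then UNIV else S j i - S i j"]
      unfolding D_def by auto
    then show ?thesis by blast
  qed
  ultimately show ?thesis
    unfolding disjoint_family_on_def by blast
qed

section \<open>Borel maps into Baire space and Borel images\<close>

lemma measurable_baireI:
  assumes "\<And>i. (\<lambda>x. f x i) \<in> M \<rightarrow>\<^sub>M count_space UNIV"
  shows "f \<in> M \<rightarrow>\<^sub>M (borel :: baire measure)"
  using assms measurable_cong_sets[OF refl sets_borel_eq_count_space[where ?'a=nat]]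
  by (intro measurable_coordinatewise_then_product) auto

lemma measurable_baireD:
  assumes "f \<in> M \<rightarrow>\<^sub>M (borel :: baire measure)"
  shows "(\<lambda>x. f x i) \<in> M \<rightarrow>\<^sub>M count_space UNIV"
  using measurable_product_then_coordinatewise[OF assms, of i]
    measurable_cong_sets[OF refl sets_borel_eq_count_space[where ?'a=nat]] by auto

lemma sets_Collect_eq_baire:
  fixes f g :: "'a \<Rightarrow> baire"
  assumes "f \<in> M \<rightarrow>\<^sub>M borel" "g \<in> M \<rightarrow>\<^sub>M borel"
  shows "{x \<in> space M. f x = g x} \<in> sets M"
proof -
  define a b where "a i x = f x i" and "b i x = g x i" for i x
  have [measurable]: "a i \<in> M \<rightarrow>\<^sub>M count_space UNIV" "b i \<in> M \<rightarrow>\<^sub>M count_space UNIV" for i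
    unfolding a_def b_def by (intro measurable_baireD assms)+
  have "{x \<in> space M. \<forall>i. \<exists>k. a i x = k \<and> b i x = k} \<in> sets M"
    by measurable
  then show ?thesis
    by (simp add: fun_eq_iff a_def b_def eq_commute)
qed

text \<open>The inverse is read off digit by digit: points with different \<open>n\<close>-th digits
  have images in disjoint analytic sets, which separation encloses in disjoint Borel sets. The
  condition on \<open>S\<close> is phrased through images because \<open>robust_split\<close>
  applies it to a set defined by analytic conditions.\<close>

lemma borel_left_inverse:
  fixes S :: "baire set"
  assumes "inj_on g S" "\<And>n k. analytic (g ` {z \<in> S. z n = k})"
  shows "\<exists>h\<in>borel \<rightarrow>\<^sub>M borel. \<forall>z\<in>S. h (g z) = z"
proof -
  have "\<exists>D. (\<forall>k. D k \<in> sets borel) \<and> (\<forall>k. g ` {z \<in> S. z n = k} \<subseteq> D k) \<and> disjoint_family D" for n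
  proof -
    have "disjoint_family (\<lambda>k. g ` {z \<in> S. z n = k})"
      using inj_onD[OF assms(1)] unfolding disjoint_family_on_def by blast
    with assms(2) show ?thesis
      by (rule analytic_separation_family)
  qed
  then have "\<exists>D. \<forall>n. (\<forall>k. D n k \<in> sets borel) \<and> (\<forall>k. g ` {z \<in> S. z n = k} \<subseteq> D n k) \<and> disjoint_family (D n)"
    by (intro choice allI)
  then obtain D where "\<forall>n. (\<forall>k. D n k \<in> sets borel) \<and> (\<forall>k. g ` {z \<in> S. z n = k} \<subseteq> D n k) \<and> disjoint_family (D n)" ..
  then have D: "D n k \<in> sets borel" "g ` {z \<in> S. z n = k} \<subseteq> D n k" "disjoint_family (D n)" for n k
    by simp_all
  define h where "h x n = (LEAST k. x \<in> D n k)" for x n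
  have "h \<in> borel \<rightarrow>\<^sub>M borel"
  proof (rule measurable_baireI)
    fix n
    have "Measurable.pred borel (\<lambda>x. x \<in> D n k)" for k
      using D(1) by measurable
    then show "(\<lambda>x. h x n) \<in> borel \<rightarrow>\<^sub>M count_space UNIV"
      unfolding h_def by (rule measurable_Least)
  qed
  moreover have "h (g z) = z" if "z \<in> S" for z
  proof
    fix n
    have *: "g z \<in> D n (z n)"
      using D(2) that by blast
    then have "g z \<in> D n k \<longleftrightarrow> k = z n" for k
      using D(3)[of n] unfolding disjoint_family_on_def by blast
    then show "h (g z) n = z n"
      unfolding h_def by (simp add: Least_equality)
  qed
  ultimately show ?thesis
    by blast
qed

lemma borel_measurable_if_continuous_on:
  fixes g :: "baire \<Rightarrow> baire"
  assumes "B \<in> sets borel" "continuous_on B g"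
  shows "(\<lambda>z. if z \<in> B then g z else z) \<in> borel \<rightarrow>\<^sub>M borel"
  using assms by (intro borel_measurable_continuous_on_if continuous_on_id)

text \<open>The Lusin--Souslin theorem. With a closed injective coding of the image, the pieces with
  a given digit are closed, so a Borel left inverse \<open>h\<close> exists. A point is in the image
  iff \<open>h\<close> sends it into the domain and the coding sends it back, which is a Borel
  condition.\<close>

theorem borel_inj_image:
  fixes g :: "baire \<Rightarrow> baire"
  assumes "B \<in> sets borel" "continuous_on B g" "inj_on g B"
  shows "g ` B \<in> sets borel"
proof -
  have "closed_image True (g ` B)"
    using assms by (intro closed_image_image borel_closed_image)
  then obtain F and f :: "baire \<Rightarrow> baire" where
    F: "closed F" "continuous_on F f" "inj_on f F" "f ` F = g ` B"
    unfolding closed_image_def by auto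
  have "analytic (f ` {z \<in> F. z n = k})" for n k
  proof (rule closed_imageI)
    have "{z \<in> F. z n = k} = F \<inter> {z. z n \<in> {k}}"
      by auto
    then show "closed {z \<in> F. z n = k}"
      using F(1) closed_coordinate[of n "{k}"] by (simp only: closed_Int)
    show "continuous_on {z \<in> F. z n = k} f"
      by (rule continuous_on_subset[OF F(2)]) auto
  qed simp
  then obtain h :: "baire \<Rightarrow> baire" where h: "h \<in> borel \<rightarrow>\<^sub>M borel" "\<And>z. z \<in> F \<Longrightarrow> h (f z) = z"
    using borel_left_inverse[OF F(3)] by blast
  let ?f = "\<lambda>z. if z \<in> F then f z else z"
  have "{x \<in> space borel. ?f (h x) = x} \<in> sets borel"
    using F by (intro sets_Collect_eq_baire measurable_compose[OF h(1) borel_measurable_if_continuous_on]) auto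
  moreover have "h -` F \<inter> space borel \<in> sets borel"
    using F(1) by (intro measurable_sets[OF h(1)]) auto
  moreover have "f ` F = {x \<in> space borel. ?f (h x) = x} \<inter> (h -` F \<inter> space borel)"
  proof (intro equalityI subsetI)
    fix x assume "x \<in> f ` F"
    then obtain z where "z \<in> F" "x = f z" by blast
    then show "x \<in> {x \<in> space borel. ?f (h x) = x} \<inter> (h -` F \<inter> space borel)"
      using h(2)[of z] by simp
  next
    fix x assume "x \<in> {x \<in> space borel. ?f (h x) = x} \<inter> (h -` F \<inter> space borel)"
    then have "h x \<in> F" "f (h x) = x" by auto
    then show "x \<in> f ` F" by (metis image_eqI)
  qed
  ultimately show ?thesis
    using F(4) using sets.Int by simp
qed

section \<open>The Lusin--Novikov theorem\<close>

definition cylinder :: "nat list \<Rightarrow> baire set" where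
  "cylinder s = {z. \<forall>i<length s. z i = s ! i}"

lemma cylinder_Nil [simp]: "cylinder [] = UNIV"
  by (simp add: cylinder_def)

lemma in_cylinder_map: "z \<in> cylinder (map z [0..<n])"
  by (simp add: cylinder_def)

lemma cylinder_map_subset:
  assumes "z \<in> cylinder s" "length s \<le> n"
  shows "cylinder (map z [0..<n]) \<subseteq> cylinder s"
  using assms by (auto simp: cylinder_def)

lemma cylinder_disjoint: "length s = length t \<Longrightarrow> s \<noteq> t \<Longrightarrow> cylinder s \<inter> cylinder t = {}"
  by (auto simp: cylinder_def list_eq_iff_nth_eq)

lemma borel_cylinder: "cylinder s \<in> sets borel"
proof -
  have eq: "cylinder s = (\<Inter>i\<in>{..<length s}. {z. z i \<in> {s ! i}})"
    by (auto simp: cylinder_def)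
  show ?thesis
    unfolding eq by (intro borel_closed closed_INT ballI closed_coordinate)
qed

lemma analytic_image_borel:
  fixes g :: "baire \<Rightarrow> baire"
  assumes "B \<in> sets borel" "continuous_on B g"
  shows "analytic (g ` B)"
  by (rule closed_image_image[OF borel_closed_image[OF assms(1)] assms(2)]) simp

lemma analytic_finite_INT:
  assumes "finite I" "\<And>i. i \<in> I \<Longrightarrow> analytic (A i)"
  shows "analytic (\<Inter>i\<in>I. A i)"
  using assms
proof induction
  case empty
  show ?case
    by (simp add: closed_image_closed)
next
  case (insert i I)
  then show ?case
    by (simp add: closed_image_Int)
qed

text \<open>Sets of this kind form the \<open>\<sigma>\<close>-ideal of negligible sets in the proof of the
  Lusin--Novikov theorem.\<close>

definition inj_covered :: "(baire \<Rightarrow> baire) \<Rightarrow> baire set \<Rightarrow> baire set \<Rightarrow> bool" where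
  "inj_covered g F Q \<longleftrightarrow> Q \<subseteq> F \<and>
     (\<exists>K :: nat \<Rightarrow> baire set. (\<forall>n. K n \<in> sets borel \<and> inj_on g (K n)) \<and> Q = (\<Union>n. K n))"

lemma inj_coveredD:
  assumes "inj_covered g F Q"
  shows "Q \<subseteq> F" "Q \<in> sets borel"
  using assms unfolding inj_covered_def by auto

lemma inj_covered_single:
  assumes "Q \<in> sets borel" "Q \<subseteq> F" "inj_on g Q"
  shows "inj_covered g F Q"
  unfolding inj_covered_def using assms by (intro conjI exI[of _ "\<lambda>_. Q"]) auto

lemma inj_covered_UN:
  fixes Q :: "nat \<Rightarrow> baire set"
  assumes "\<And>n. inj_covered g F (Q n)"
  shows "inj_covered g F (\<Union>n. Q n)"
proof -
  have "\<forall>n. \<exists>K :: nat \<Rightarrow> baire set. (\<forall>m. K m \<in> sets borel \<and> inj_on g (K m)) \<and> Q n = (\<Union>m. K m)"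
    using assms unfolding inj_covered_def by blast
  from choice[OF this] obtain K :: "nat \<Rightarrow> nat \<Rightarrow> baire set" where
    K: "\<forall>n. (\<forall>m. K n m \<in> sets borel \<and> inj_on g (K n m)) \<and> Q n = (\<Union>m. K n m)" ..
  have "(\<Union>n. Q n) = (\<Union>k. K (fst (prod_decode k)) (snd (prod_decode k)))"
  proof (intro equalityI subsetI)
    fix x assume "x \<in> (\<Union>n. Q n)"
    then obtain n m where "x \<in> K n m"
      using K by auto
    then have "x \<in> K (fst (prod_decode (prod_encode (n, m)))) (snd (prod_decode (prod_encode (n, m))))"
      by simp
    then show "x \<in> (\<Union>k. K (fst (prod_decode k)) (snd (prod_decode k)))"
      by blast
  next
    fix x assume "x \<in> (\<Union>k. K (fst (prod_decode k)) (snd (prod_decode k)))"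
    then show "x \<in> (\<Union>n. Q n)"
      using K by auto
  qed
  moreover have "(\<Union>n. Q n) \<subseteq> F"
    using assms inj_coveredD(1) by blast
  ultimately show ?thesis
    unfolding inj_covered_def
    using K by (intro conjI exI[of _ "\<lambda>k. K (fst (prod_decode k)) (snd (prod_decode k))"]) auto
qed

lemma inj_covered_empty: "inj_covered g F {}"
  by (rule inj_covered_single) auto

lemma inj_covered_Un:
  assumes "inj_covered g F P" "inj_covered g F Q"
  shows "inj_covered g F (P \<union> Q)"
proof -
  have "inj_covered g F (\<Union>n::nat. if n = 0 then P else Q)"
    by (rule inj_covered_UN) (use assms in auto)
  also have "(\<Union>n::nat. if n = 0 then P else Q) = P \<union> Q"
    by (auto split: if_splits)
  finally show ?thesis .
qed

definition common_fibre :: "(baire \<Rightarrow> baire) \<Rightarrow> baire set \<Rightarrow> nat list set \<Rightarrow> bool" where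
  "common_fibre g E \<Sigma> \<longleftrightarrow> (\<exists>x. \<forall>s\<in>\<Sigma>. \<exists>z\<in>E \<inter> cylinder s. g z = x)"

text \<open>Positivity with respect to the ideal of negligible sets: no negligible set destroys the
  common fibre. For \<open>{[]}\<close> it says exactly that \<open>F\<close> is not
  negligible.\<close>

definition robust :: "(baire \<Rightarrow> baire) \<Rightarrow> baire set \<Rightarrow> nat list set \<Rightarrow> bool" where
  "robust g F \<Sigma> \<longleftrightarrow> (\<forall>Q. inj_covered g F Q \<longrightarrow> common_fibre g (F - Q) \<Sigma>)"

lemma robustD: "robust g F \<Sigma> \<Longrightarrow> inj_covered g F Q \<Longrightarrow> common_fibre g (F - Q) \<Sigma>"
  unfolding robust_def by blast

lemma common_fibre_mono: "common_fibre g E \<Sigma> \<Longrightarrow> E \<subseteq> E' \<Longrightarrow> common_fibre g E' \<Sigma>"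
  unfolding common_fibre_def by blast

text \<open>Equal length together with \<open>u \<noteq> v\<close> makes the two cylinders disjoint;
  the strict increase in length makes the cylinders of the scheme shrink to points.\<close>

definition splits :: "nat list \<Rightarrow> nat list \<Rightarrow> nat list \<Rightarrow> bool" where
  "splits s u v \<longleftrightarrow> length u = length v \<and> u \<noteq> v \<and> length s < length u \<and>
     cylinder u \<subseteq> cylinder s \<and> cylinder v \<subseteq> cylinder s"

text \<open>If no splitting of \<open>s\<close> were robust, then after removing countably many negligible sets the points
  in the cylinder of \<open>s\<close> that extend to a common fibre would be determined by their image under \<open>g\<close>, so
  they would form a negligible set as well.\<close>

lemma robust_split:
  assumes F: "closed F" and g: "continuous_on F g"
    and "finite \<Sigma>" and robust: "robust g F (insert s \<Sigma>)"
  shows "\<exists>u v. splits s u v \<and> robust g F (insert u (insert v \<Sigma>))"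
proof (rule ccontr)
  assume none: "\<nexists>u v. splits s u v \<and> robust g F (insert u (insert v \<Sigma>))"
  \<comment> \<open>For pairs that do not split \<open>s\<close> the empty set will do, so one
    choice function covers the countable type of all pairs.\<close>
  have "\<forall>p. \<exists>Q. inj_covered g F Q \<and> (splits s (fst p) (snd p) \<longrightarrow>
      \<not> common_fibre g (F - Q) (insert (fst p) (insert (snd p) \<Sigma>)))"
    using none inj_covered_empty[of g F] unfolding robust_def by blast
  from choice[OF this] obtain Q where
    Q: "\<forall>p. inj_covered g F (Q p) \<and> (splits s (fst p) (snd p) \<longrightarrow>
      \<not> common_fibre g (F - Q p) (insert (fst p) (insert (snd p) \<Sigma>)))" ..
  define R where "R = (\<Union>n. Q (from_nat n))"
  have R: "inj_covered g F R"
    unfolding R_def by (rule inj_covered_UN) (use Q in blast)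
  have Q_sub: "Q (u, v) \<subseteq> R" for u v
    unfolding R_def using UN_upper[of "to_nat (u, v)" UNIV "\<lambda>n. Q (from_nat n)"] by simp
  define T where "T t = (F - R) \<inter> cylinder t" for t
  define S where "S = {z \<in> T s. g z \<in> (\<Inter>t\<in>\<Sigma>. g ` T t)}"
  have T: "T t \<in> sets borel" "T t \<subseteq> F" for t
    using F inj_coveredD(2)[OF R] borel_cylinder[of t] by (auto simp: T_def)
  have inj: "inj_on g S"
  proof (rule inj_onI, rule ccontr)
    fix z z' assume z: "z \<in> S" "z' \<in> S" "g z = g z'" "z \<noteq> z'"
    then obtain i where i: "z i \<noteq> z' i"
      by blast
    \<comment> \<open>Past both the place where \<open>z\<close> and \<open>z'\<close> differ and
      the end of \<open>s\<close>: the prefixes are then distinct and properly longer than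
      \<open>s\<close>.\<close>
    define m where "m = Suc (max i (length s))"
    define u v where "u = map z [0..<m]" and "v = map z' [0..<m]"
    have "u ! i = z i" "v ! i = z' i"
      by (simp_all add: u_def v_def m_def less_Suc_eq_le nth_append del: upt_Suc)
    then have "u \<noteq> v"
      using i by auto
    have "splits s u v"
      using z \<open>u \<noteq> v\<close> cylinder_map_subset[of z s m] cylinder_map_subset[of z' s m]
      by (auto simp: splits_def S_def T_def u_def v_def m_def)
    moreover have "common_fibre g (F - R) (insert u (insert v \<Sigma>))"
      unfolding common_fibre_def
    proof (intro exI[of _ "g z"] ballI)
      fix t assume "t \<in> insert u (insert v \<Sigma>)"
      then consider "t = u" | "t = v" | "t \<in> \<Sigma>" by blast
      then show "\<exists>w\<in>(F - R) \<inter> cylinder t. g w = g z"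
      proof cases
        case 1
        then show ?thesis
          using z in_cylinder_map[of z m] by (auto simp: S_def T_def u_def)
      next
        case 2
        then show ?thesis
          using z in_cylinder_map[of z' m] by (auto simp: S_def T_def v_def intro!: bexI[of _ z'])
      next
        case 3
        then have "g z \<in> g ` T t"
          using z(1) by (auto simp: S_def)
        then show ?thesis
          by (auto simp: T_def)
      qed
    qed
    then have "common_fibre g (F - Q (u, v)) (insert u (insert v \<Sigma>))"
      by (rule common_fibre_mono) (use Q_sub in blast)
    ultimately show False
      using Q[rule_format, of "(u, v)"] by simp
  qed
  have "analytic (g ` {z \<in> S. z n = k})" for n k
  proof -
    have "g ` {z \<in> S. z n = k} = g ` (T s \<inter> {z. z n \<in> {k}}) \<inter> (\<Inter>t\<in>\<Sigma>. g ` T t)"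
      by (auto simp: S_def)
    moreover have "T s \<inter> {z. z n \<in> {k}} \<in> sets borel"
      by (intro sets.Int T(1) borel_open open_coordinate)
    then have "analytic (g ` (T s \<inter> {z. z n \<in> {k}}))"
      by (rule analytic_image_borel) (use T(2) in \<open>blast intro: continuous_on_subset[OF g]\<close>)
    moreover have "analytic (g ` T t)" for t
      by (rule analytic_image_borel[OF T(1) continuous_on_subset[OF g T(2)]])
    then have "analytic (\<Inter>t\<in>\<Sigma>. g ` T t)"
      using \<open>finite \<Sigma>\<close> by (intro analytic_finite_INT)
    ultimately show ?thesis
      by (simp only: closed_image_Int)
  qed
  from borel_left_inverse[OF inj this] obtain h :: "baire \<Rightarrow> baire" where
    h: "h \<in> borel \<rightarrow>\<^sub>M borel" "\<forall>z\<in>S. h (g z) = z" by blast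
  \<comment> \<open>\<open>S\<close> is cut out by analytic conditions and need not be Borel. All
    points of \<open>F\<close> recovered by \<open>h\<close> form a Borel superset on which
    \<open>h\<close> still witnesses injectivity, and this superset is negligible.\<close>
  define S' where "S' = {z \<in> F. h (g z) = z}"
  let ?g = "\<lambda>z. if z \<in> F then g z else z"
  have "{z \<in> space borel. h (?g z) = z} \<in> sets borel"
    using F g by (intro sets_Collect_eq_baire measurable_compose[OF borel_measurable_if_continuous_on h(1)]) auto
  then have "F \<inter> {z \<in> space borel. h (?g z) = z} \<in> sets borel"
    using F by (intro sets.Int) auto
  also have "F \<inter> {z \<in> space borel. h (?g z) = z} = S'"
    by (auto simp: S'_def)
  finally have "S' \<in> sets borel" .
  moreover have "S' \<subseteq> F"
    unfolding S'_def by blast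
  moreover have "inj_on g S'"
    by (rule inj_on_inverseI[of _ h]) (simp add: S'_def)
  ultimately have "inj_covered g F S'"
    by (rule inj_covered_single)
  with R have "inj_covered g F (R \<union> S')"
    by (rule inj_covered_Un)
  \<comment> \<open>The point that this yields in the cylinder of \<open>s\<close> has partners in
    all other cylinders, hence lies in \<open>S\<close>, although it avoids the larger set
    \<open>S'\<close>.\<close>
  then have "common_fibre g (F - (R \<union> S')) (insert s \<Sigma>)"
    using robust unfolding robust_def by blast
  then obtain x where x: "\<forall>t\<in>insert s \<Sigma>. \<exists>z\<in>(F - (R \<union> S')) \<inter> cylinder t. g z = x"
    unfolding common_fibre_def by blast
  then obtain z where z: "z \<in> F" "z \<notin> R" "z \<notin> S'" "z \<in> cylinder s" "g z = x"
    by blast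
  have "x \<in> g ` T t" if "t \<in> \<Sigma>" for t
    using x that unfolding T_def by blast
  then have "z \<in> S"
    using z by (auto simp: S_def T_def)
  then show False
    using h(2) z by (auto simp: S'_def)
qed

text \<open>Cylinders are split one at a time, but the common fibre must be kept for all of them
  together. \<open>\<Delta>\<close> holds those left alone for the moment: in the induction step
  \<open>s\<close> waits there while the rest is split.\<close>

lemma robust_split_all:
  assumes F: "closed F" and g: "continuous_on F g" and "finite \<Sigma>"
  shows "finite \<Delta> \<Longrightarrow> robust g F (\<Sigma> \<union> \<Delta>) \<Longrightarrow>
    \<exists>\<Sigma>'. finite \<Sigma>' \<and> robust g F (\<Sigma>' \<union> \<Delta>) \<and> (\<forall>s\<in>\<Sigma>. \<exists>u\<in>\<Sigma>'. \<exists>v\<in>\<Sigma>'. splits s u v) \<and>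
      (\<forall>u\<in>\<Sigma>'. \<exists>s\<in>\<Sigma>. length s < length u)"
  using \<open>finite \<Sigma>\<close>
proof (induction \<Sigma> arbitrary: \<Delta>)
  case empty
  then show ?case
    by (intro exI[of _ "{}"]) auto
next
  case (insert s \<Sigma>)
  have "finite (insert s \<Delta>)" "robust g F (\<Sigma> \<union> insert s \<Delta>)"
    using insert.prems by auto
  from insert.IH[OF this] obtain \<Sigma>' where
    \<Sigma>': "finite \<Sigma>'" "robust g F (\<Sigma>' \<union> insert s \<Delta>)" "\<forall>s\<in>\<Sigma>. \<exists>u\<in>\<Sigma>'. \<exists>v\<in>\<Sigma>'. splits s u v"
    "\<forall>u\<in>\<Sigma>'. \<exists>s\<in>\<Sigma>. length s < length u" by blast
  have "robust g F (insert s (\<Sigma>' \<union> \<Delta>))" "finite (\<Sigma>' \<union> \<Delta>)"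
    using \<Sigma>' insert.prems by auto
  then obtain u v where uv: "splits s u v" "robust g F (insert u (insert v (\<Sigma>' \<union> \<Delta>)))"
    using robust_split[OF F g] by blast
  show ?case
  proof (intro exI[of _ "insert u (insert v \<Sigma>')"] conjI)
    show "\<forall>t\<in>insert s \<Sigma>. \<exists>u'\<in>insert u (insert v \<Sigma>'). \<exists>v'\<in>insert u (insert v \<Sigma>'). splits t u' v'"
      using \<Sigma>'(3) uv(1) by blast
    show "\<forall>u'\<in>insert u (insert v \<Sigma>'). \<exists>t\<in>insert s \<Sigma>. length t < length u'"
      using \<Sigma>'(4) uv(1) unfolding splits_def by auto
  qed (use \<Sigma>' uv in auto)
qed

text \<open>Robust finite sets of cylinders can be refined to a Cantor scheme.  By continuity \<open>g\<close> is constant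
  on the limit set \<open>P\<close> of the scheme, and \<open>P\<close> is uncountable because every enumeration
  \<open>w\<close> of points can be avoided along a branch.\<close>

lemma inj_covered_domain:
  assumes F: "closed F" and g: "continuous_on F g" and fibres: "\<And>x. countable {z \<in> F. g z = x}"
  shows "inj_covered g F F"
proof (rule ccontr)
  assume "\<not> inj_covered g F F"
  have "common_fibre g (F - Q) {[]}" if "inj_covered g F Q" for Q
  proof -
    have "Q \<noteq> F" "Q \<subseteq> F"
      using that \<open>\<not> inj_covered g F F\<close> inj_coveredD(1)[OF that] by auto
    then show ?thesis
      unfolding common_fibre_def by auto
  qed
  then have start: "robust g F {[]}"
    unfolding robust_def by blast
  have "\<exists>\<Sigma>. \<forall>n. (finite (\<Sigma> n) \<and> robust g F (\<Sigma> n) \<and> (\<forall>s\<in>\<Sigma> n. n \<le> length s) \<and> (n = 0 \<longrightarrow> \<Sigma> n = {[]})) \<and>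
      (\<forall>s\<in>\<Sigma> n. \<exists>u\<in>\<Sigma> (Suc n). \<exists>v\<in>\<Sigma> (Suc n). splits s u v)"
  proof (rule dependent_nat_choice)
    show "\<exists>\<Sigma>. finite \<Sigma> \<and> robust g F \<Sigma> \<and> (\<forall>s\<in>\<Sigma>. 0 \<le> length s) \<and> (0 = (0::nat) \<longrightarrow> \<Sigma> = {[]})"
      using start by (intro exI[of _ "{[]}"]) simp
  next
    fix \<Sigma> and n :: nat
    assume *: "finite \<Sigma> \<and> robust g F \<Sigma> \<and> (\<forall>s\<in>\<Sigma>. n \<le> length s) \<and> (n = 0 \<longrightarrow> \<Sigma> = {[]})"
    then have "finite \<Sigma>" "robust g F (\<Sigma> \<union> {})"
      by simp_all
    from robust_split_all[OF F g this(1) finite.emptyI this(2)] obtain \<Sigma>' where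
      \<Sigma>': "finite \<Sigma>'" "robust g F (\<Sigma>' \<union> {})" "\<forall>s\<in>\<Sigma>. \<exists>u\<in>\<Sigma>'. \<exists>v\<in>\<Sigma>'. splits s u v"
      "\<forall>u\<in>\<Sigma>'. \<exists>s\<in>\<Sigma>. length s < length u" by blast
    have "\<forall>u\<in>\<Sigma>'. Suc n \<le> length u"
    proof
      fix u assume "u \<in> \<Sigma>'"
      then obtain t where "t \<in> \<Sigma>" "length t < length u"
        using \<Sigma>'(4) by blast
      moreover have "n \<le> length t"
        using * \<open>t \<in> \<Sigma>\<close> by simp
      ultimately show "Suc n \<le> length u"
        by linarith
    qed
    with \<Sigma>' show "\<exists>\<Sigma>'. (finite \<Sigma>' \<and> robust g F \<Sigma>' \<and> (\<forall>s\<in>\<Sigma>'. Suc n \<le> length s) \<and> (Suc n = 0 \<longrightarrow> \<Sigma>' = {[]})) \<and>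
        (\<forall>s\<in>\<Sigma>. \<exists>u\<in>\<Sigma>'. \<exists>v\<in>\<Sigma>'. splits s u v)"
      by (intro exI[of _ \<Sigma>']) simp
  qed
  then obtain \<Sigma> where \<Sigma>: "\<forall>n. (finite (\<Sigma> n) \<and> robust g F (\<Sigma> n) \<and> (\<forall>s\<in>\<Sigma> n. n \<le> length s) \<and> (n = 0 \<longrightarrow> \<Sigma> n = {[]})) \<and>
      (\<forall>s\<in>\<Sigma> n. \<exists>u\<in>\<Sigma> (Suc n). \<exists>v\<in>\<Sigma> (Suc n). splits s u v)" ..
  have \<Sigma>_0: "\<Sigma> 0 = {[]}"
    using spec[OF \<Sigma>, of 0] by simp
  have \<Sigma>_robust: "robust g F (\<Sigma> n)" for n
    using spec[OF \<Sigma>, of n] by simp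
  have \<Sigma>_length: "n \<le> length s" if "s \<in> \<Sigma> n" for n s
    using spec[OF \<Sigma>, of n] that by simp
  have \<Sigma>_splits: "\<exists>u\<in>\<Sigma> (Suc n). \<exists>v\<in>\<Sigma> (Suc n). splits s u v" if "s \<in> \<Sigma> n" for n s
    using spec[OF \<Sigma>, of n] that by simp
  define P where "P = {z. \<forall>n. \<exists>s\<in>\<Sigma> n. z \<in> cylinder s}"
  \<comment> \<open>Nothing needs to be removed any more: robustness against negligible sets served
    to build the scheme.\<close>
  have common: "\<exists>x. \<forall>s\<in>\<Sigma> n. \<exists>w\<in>F \<inter> cylinder s. g w = x" for n
  proof -
    have "common_fibre g (F - {}) (\<Sigma> n)"
      by (rule robustD[OF \<Sigma>_robust inj_covered_empty])
    then show ?thesis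
      unfolding common_fibre_def by simp
  qed
  have agree: "w i = z i" if "s \<in> \<Sigma> n" "z \<in> cylinder s" "w \<in> cylinder s" "i < n" for n s z w i
  proof -
    have "i < length s"
      using \<Sigma>_length[OF that(1)] that(4) by linarith
    then show ?thesis
      using that by (simp add: cylinder_def)
  qed
  have P_sub: "z \<in> F" if "z \<in> P" for z
  proof (rule closed_cylinder[OF F])
    fix n
    obtain s where s: "s \<in> \<Sigma> n" "z \<in> cylinder s"
      using \<open>z \<in> P\<close> unfolding P_def by blast
    with common[of n] obtain w where "w \<in> F" "w \<in> cylinder s"
      by blast
    with agree[OF s] show "\<exists>w\<in>F. \<forall>i<n. w i = z i"
      by blast
  qed
  have const: "g z = g z'" if zP: "z \<in> P" "z' \<in> P" for z z'
  proof
    fix i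
    obtain n where n: "\<And>w. w \<in> F \<Longrightarrow> (\<And>j. j < n \<Longrightarrow> w j = z j) \<Longrightarrow> g w \<in> {y. y i \<in> {g z i}}"
      using continuous_on_cylinder[OF g P_sub[OF zP(1)] open_coordinate[of i "{g z i}"]] by blast
    obtain m where m: "\<And>w. w \<in> F \<Longrightarrow> (\<And>j. j < m \<Longrightarrow> w j = z' j) \<Longrightarrow> g w \<in> {y. y i \<in> {g z' i}}"
      using continuous_on_cylinder[OF g P_sub[OF zP(2)] open_coordinate[of i "{g z' i}"]] by blast
    let ?N = "max n m"
    obtain s where s: "s \<in> \<Sigma> ?N" "z \<in> cylinder s"
      using zP(1) unfolding P_def by blast
    obtain s' where s': "s' \<in> \<Sigma> ?N" "z' \<in> cylinder s'"
      using zP(2) unfolding P_def by blast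
    obtain w w' where w: "w \<in> F" "w \<in> cylinder s" "w' \<in> F" "w' \<in> cylinder s'" "g w = g w'"
      using common[of ?N] s(1) s'(1) by (metis IntE)
    have "g w \<in> {y. y i \<in> {g z i}}"
      by (rule n[OF w(1)]) (use agree[OF s w(2)] in simp)
    moreover have "g w' \<in> {y. y i \<in> {g z' i}}"
      by (rule m[OF w(3)]) (use agree[OF s' w(4)] in simp)
    ultimately show "g z i = g z' i"
      using w(5) by simp
  qed
  have avoid: "\<exists>z\<in>P. \<forall>n. z \<noteq> w n" for w :: "nat \<Rightarrow> baire"
  proof -
    \<comment> \<open>The two halves of a splitting are disjoint, so at stage \<open>n\<close> one
      of them misses \<open>w n\<close>.\<close>
    have "\<exists>s. \<forall>n. s n \<in> \<Sigma> n \<and> (cylinder (s (Suc n)) \<subseteq> cylinder (s n) \<and> w n \<notin> cylinder (s (Suc n)))"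
    proof (rule dependent_nat_choice)
      show "\<exists>s. s \<in> \<Sigma> 0"
        using \<Sigma>_0 by blast
    next
      fix s n assume "s \<in> \<Sigma> n"
      then obtain u v where uv: "u \<in> \<Sigma> (Suc n)" "v \<in> \<Sigma> (Suc n)" "splits s u v"
        using \<Sigma>_splits by blast
      then have "cylinder u \<inter> cylinder v = {}"
        by (intro cylinder_disjoint) (auto simp: splits_def)
      with uv show "\<exists>t. t \<in> \<Sigma> (Suc n) \<and> cylinder t \<subseteq> cylinder s \<and> w n \<notin> cylinder t"
        unfolding splits_def by blast
    qed
    then obtain s where s: "\<forall>n. s n \<in> \<Sigma> n \<and> (cylinder (s (Suc n)) \<subseteq> cylinder (s n) \<and> w n \<notin> cylinder (s (Suc n)))" ..
    have anti: "cylinder (s m) \<subseteq> cylinder (s n)" if "n \<le> m" for n m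
      by (rule lift_Suc_antimono_le[of "\<lambda>n. cylinder (s n)", OF _ that]) (use s in blast)
    define z where "z i = s (Suc i) ! i" for i
    have "z \<in> cylinder (s n)" for n
    proof -
      have "z i = s n ! i" if "i < length (s n)" for i
      proof -
        \<comment> \<open>A point following a string late enough to lie in both cylinders, through
          which their entries are compared. Its values past the end of that string do not
          matter.\<close>
        define y where "y j = s (max n (Suc i)) ! j" for j
        have "y \<in> cylinder (s (max n (Suc i)))"
          by (simp add: y_def cylinder_def)
        then have "y \<in> cylinder (s n)" "y \<in> cylinder (s (Suc i))"
          using anti[of n "max n (Suc i)"] anti[of "Suc i" "max n (Suc i)"] by auto
        moreover have "i < length (s (Suc i))"
          using \<Sigma>_length[of "s (Suc i)" "Suc i"] s by (simp add: Suc_le_eq)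
        ultimately have "y i = s n ! i" "y i = s (Suc i) ! i"
          using that unfolding cylinder_def by blast+
        then show ?thesis
          by (simp add: z_def)
      qed
      then show ?thesis
        by (simp add: cylinder_def)
    qed
    then have "z \<in> P" "z \<noteq> w n" for n
      using s unfolding P_def by blast+
    then show ?thesis
      by blast
  qed
  obtain z0 where z0: "z0 \<in> P"
    using avoid by blast
  have "P \<subseteq> {z \<in> F. g z = g z0}"
    using P_sub const z0 by blast
  then have "countable P"
    using fibres countable_subset by blast
  with z0 avoid[of "from_nat_into P"] show False
    by (metis empty_iff from_nat_into_surj)
qed

text \<open>A bijective coding by a closed set keeps fibres countable and reduces to
  \<open>inj_covered_domain\<close>. The pieces found there are carried back by the Lusin--Souslin
  theorem.\<close>

theorem lusin_novikov:
  fixes H :: "baire set" and g :: "baire \<Rightarrow> baire"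
  assumes H: "H \<in> sets borel" and g: "continuous_on H g" and fibres: "\<And>x. countable {z \<in> H. g z = x}"
  obtains K :: "nat \<Rightarrow> baire set" where "\<forall>n. K n \<in> sets borel" "\<forall>n. inj_on g (K n)" "H = (\<Union>n. K n)"
proof -
  have "closed_image True H"
    by (rule borel_closed_image[OF H])
  then obtain F and f :: "baire \<Rightarrow> baire" where
    F: "closed F" "continuous_on F f" "inj_on f F" "f ` F = H"
    unfolding closed_image_def by blast
  have "inj_covered (g \<circ> f) F F"
  proof (rule inj_covered_domain[OF F(1)])
    show "continuous_on F (g \<circ> f)"
      using F g by (intro continuous_on_compose) auto
    show "countable {z \<in> F. (g \<circ> f) z = x}" for x
    proof (rule countable_image_inj_on)
      show "inj_on f {z \<in> F. (g \<circ> f) z = x}"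
        by (rule inj_on_subset[OF F(3)]) auto
      have "f ` {z \<in> F. (g \<circ> f) z = x} \<subseteq> {z \<in> H. g z = x}"
        using F(4) by auto
      then show "countable (f ` {z \<in> F. (g \<circ> f) z = x})"
        using fibres countable_subset by blast
    qed
  qed
  then obtain K :: "nat \<Rightarrow> baire set" where K: "\<forall>n. K n \<in> sets borel \<and> inj_on (g \<circ> f) (K n)" "F = (\<Union>n. K n)"
    unfolding inj_covered_def by blast
  have sub: "K n \<subseteq> F" for n
    using K(2) by blast
  show thesis
  proof (rule that[of "\<lambda>n. f ` K n"])
    show "\<forall>n. f ` K n \<in> sets borel"
      using K(1) sub F by (meson borel_inj_image continuous_on_subset inj_on_subset)
    show "\<forall>n. inj_on g (f ` K n)"
      using K(1) by (blast intro: inj_on_imageI)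
    show "H = (\<Union>n. f ` K n)"
      unfolding F(4)[symmetric] K(2) by blast
  qed
qed

section \<open>Coding standard Borel spaces\<close>

lemma polish_topology_onE:
  assumes "polish_topology_on X T" "space X \<noteq> {}"
  obtains M d q where "Metric_space M d" "Metric_space.mcomplete M d" "T = Metric_space.mtopology M d"
    "space X = M" "sets X = sigma_sets M {U. openin T U}" "range q \<subseteq> M"
    "\<And>x r. x \<in> M \<Longrightarrow> 0 < r \<Longrightarrow> \<exists>n::nat. d (q n) x < r"
proof -
  obtain M d where M: "Metric_space M d" "Metric_space.mcomplete M d" "T = Metric_space.mtopology M d"
    using assms(1) unfolding polish_topology_on_def polish_topology_def completely_metrizable_space_def
    by blast
  interpret Metric_space M d
    by (rule M(1))
  have X: "space X = M" "sets X = sigma_sets M {U. openin T U}"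
    using assms(1) M(3) unfolding polish_topology_on_def by auto
  obtain C where C: "countable C" "C \<subseteq> M" "mtopology closure_of C = M"
    using assms(1) M(3) unfolding polish_topology_on_def polish_topology_def separable_space_def by auto
  then have "C \<noteq> {}"
    using assms(2) X(1) by auto
  then have q: "range (from_nat_into C) = C"
    using C(1) by (rule range_from_nat_into)
  have "\<exists>n. d (from_nat_into C n) x < r" if x: "x \<in> M" "0 < r" for x r
  proof -
    have "x \<in> {x \<in> M. \<forall>r>0. \<exists>y\<in>C. y \<in> mball x r}"
      using x(1) C(3) unfolding metric_closure_of by simp
    then obtain y where "y \<in> C" "d x y < r"
      using x(2) by auto
    moreover obtain n where "from_nat_into C n = y"
      using q \<open>y \<in> C\<close> by (metis imageE)
    ultimately show ?thesis
      by (metis commute)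
  qed
  with M X q C(2) show thesis
    by (intro that[of M d "from_nat_into C"]) auto
qed

text \<open>A point \<open>x\<close> is coded by the sequence whose \<open>m\<close>-th term is the index of the first point of a dense
  sequence \<open>q\<close> at distance less than \<open>2\<^sup>-\<^sup>m\<close> from \<open>x\<close>.  A sequence \<open>z\<close> is a code iff
  \<open>q (z m)\<close> is Cauchy at the expected rate and the indices are minimal for its limit.  Distances from
  the limit are limits of the distances from \<open>q (z m)\<close>, so this is a Borel condition on \<open>z\<close>.\<close>

theorem standard_borel_retract:
  assumes "standard_borel_space X" "space X \<noteq> {}"
  obtains e :: "'a \<Rightarrow> baire" and r where "e \<in> X \<rightarrow>\<^sub>M borel" "r \<in> borel \<rightarrow>\<^sub>M X" "\<forall>x\<in>space X. r (e x) = x"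
proof -
  obtain T where T: "polish_topology_on X T"
    using assms(1) unfolding standard_borel_space_def by blast
  obtain M d q where M: "Metric_space M d" "Metric_space.mcomplete M d" "T = Metric_space.mtopology M d"
    and X: "space X = M" "sets X = sigma_sets M {U. openin T U}"
    and q: "range q \<subseteq> M" and dense: "\<And>x r. x \<in> M \<Longrightarrow> 0 < r \<Longrightarrow> \<exists>n::nat. d (q n) x < r"
    using polish_topology_onE[OF T assms(2)] by metis
  interpret Metric_space M d
    by (rule M(1))
  have qM: "q n \<in> M" for n
    using q by auto
  define \<delta> :: "nat \<Rightarrow> real" where "\<delta> m = (1/2) ^ m" for m
  have \<delta>_pos: "0 < \<delta> m" for m
    by (simp add: \<delta>_def)
  have \<delta>_lim: "\<delta> \<longlonglongrightarrow> 0"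
    unfolding \<delta>_def by (rule LIMSEQ_power_zero) simp
  define e :: "'a \<Rightarrow> baire" where "e x m = (LEAST n. d (q n) x < \<delta> m)" for x m
  have e_close: "d (q (e x m)) x < \<delta> m" if "x \<in> M" for x m
    unfolding e_def by (rule LeastI_ex) (use dense[OF that \<delta>_pos] in auto)
  have e_inj: "inj_on e M"
  proof (rule inj_onI)
    fix x y assume xy: "x \<in> M" "y \<in> M" "e x = e y"
    have le: "d x y \<le> 2 * \<delta> m" for m
      using triangle[OF xy(1) qM[of "e x m"] xy(2)] e_close[OF xy(1), of m] e_close[OF xy(2), of m] xy(3)
        commute[of x "q (e x m)"] by simp
    have "(\<lambda>m. 2 * \<delta> m) \<longlonglongrightarrow> 0"
      using tendsto_mult_left[OF \<delta>_lim, of 2] by simp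
    then have "d x y \<le> 0"
      by (rule LIMSEQ_le_const) (use le in blast)
    then show "x = y"
      using xy nonneg[of x y] zero[of x y] by simp
  qed
  have e_meas: "e \<in> X \<rightarrow>\<^sub>M borel"
  proof (rule measurable_baireI)
    fix m
    have "{x \<in> space X. d (q n) x < \<delta> m} \<in> sets X" for n
    proof -
      have "{x \<in> space X. d (q n) x < \<delta> m} = mball (q n) (\<delta> m)"
        unfolding X(1) mball_def using qM[of n] by auto
      then show ?thesis
        unfolding X(2) M(3) by (simp add: sigma_sets.Basic)
    qed
    then have "(\<lambda>x. d (q n) x < \<delta> m) \<in> X \<rightarrow>\<^sub>M count_space UNIV" for n
      by (simp add: pred_def)
    then show "(\<lambda>x. e x m) \<in> X \<rightarrow>\<^sub>M count_space UNIV"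
      unfolding e_def by (rule measurable_Least)
  qed
  \<comment> \<open>Using \<open>lim\<close> gives a total Borel function of \<open>z\<close>,
    whether or not the distances converge and without mentioning the limit point.\<close>
  define L where "L n z = lim (\<lambda>m. d (q (z m)) (q n))" for n and z :: baire
  have L: "L n z = d x (q n)" if "x \<in> M" "(\<lambda>m. d (q (z m)) x) \<longlonglongrightarrow> 0" for n z x
    unfolding L_def
  proof (rule limI, rule LIM_zero_cancel, rule Lim_null_comparison[OF _ that(2)])
    have "norm (d (q (z m)) (q n) - d x (q n)) \<le> d (q (z m)) x" for m
      using mdist_reverse_triangle[OF qM[of "z m"] qM[of n] that(1)] commute[of x "q n"] by simp
    then show "\<forall>\<^sub>F m in sequentially. norm (d (q (z m)) (q n) - d x (q n)) \<le> d (q (z m)) x"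
      by simp
  qed
  define Z where "Z = {z :: baire. (\<forall>m m'. d (q (z m)) (q (z m')) < \<delta> m + \<delta> m') \<and>
      (\<forall>m. L (z m) z < \<delta> m) \<and> (\<forall>m n. n < z m \<longrightarrow> \<not> L n z < \<delta> m)}"
  have Z: "e ` M = Z"
  proof (intro equalityI subsetI)
    fix z assume "z \<in> e ` M"
    then obtain x where x: "x \<in> M" and z: "z = e x" by blast
    have "(\<lambda>m. d (q (z m)) x) \<longlonglongrightarrow> 0"
    proof (rule Lim_null_comparison[OF always_eventually \<delta>_lim], rule allI)
      show "norm (d (q (z m)) x) \<le> \<delta> m" for m
        using e_close[OF x, of m] z by simp
    qed
    from L[OF x this] have Lz: "L n z = d (q n) x" for n
      by (simp add: commute)
    have "d (q (z m)) (q (z m')) < \<delta> m + \<delta> m'" for m m'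
      using triangle[OF qM[of "z m"] x qM[of "z m'"]] e_close[OF x, of m] e_close[OF x, of m']
        commute[of x "q (z m')"] z by simp
    moreover have "\<not> d (q n) x < \<delta> m" if "n < z m" for m n
      using that not_less_Least unfolding z e_def by blast
    ultimately show "z \<in> Z"
      unfolding Z_def using e_close[OF x] Lz z by auto
  next
    fix z assume z: "z \<in> Z"
    have "MCauchy (\<lambda>m. q (z m))"
      unfolding MCauchy_def
    proof (intro conjI allI impI)
      fix \<epsilon> :: real assume "0 < \<epsilon>"
      then have "\<forall>\<^sub>F m in sequentially. \<delta> m < \<epsilon> / 2"
        using \<delta>_lim by (intro order_tendstoD) auto
      then obtain N where N: "\<forall>n\<ge>N. \<delta> n < \<epsilon> / 2"
        unfolding eventually_sequentially by blast
      have "d (q (z n)) (q (z n')) < \<epsilon>" if "N \<le> n" "N \<le> n'" for n n'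
      proof -
        have "d (q (z n)) (q (z n')) < \<delta> n + \<delta> n'"
          using z unfolding Z_def by blast
        moreover have "\<delta> n < \<epsilon> / 2" "\<delta> n' < \<epsilon> / 2"
          using N that by auto
        ultimately show ?thesis
          by linarith
      qed
      then show "\<exists>N. \<forall>n n'. N \<le> n \<longrightarrow> N \<le> n' \<longrightarrow> d (q (z n)) (q (z n')) < \<epsilon>"
        by blast
    qed (use qM in auto)
    then obtain x where "limitin mtopology (\<lambda>m. q (z m)) x sequentially"
      using M(2) unfolding mcomplete_def by blast
    then have x: "x \<in> M" "\<And>\<epsilon>. 0 < \<epsilon> \<Longrightarrow> \<exists>N. \<forall>n\<ge>N. d (q (z n)) x < \<epsilon>"
      unfolding limit_metric_sequentially by blast+
    have "(\<lambda>m. d (q (z m)) x) \<longlonglongrightarrow> 0"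
      unfolding LIMSEQ_iff using x(2) nonneg by simp
    from L[OF x(1) this] have Lz: "L n z = d (q n) x" for n
      by (simp add: commute)
    have "e x m = z m" for m
      unfolding e_def
    proof (rule Least_equality)
      show "d (q (z m)) x < \<delta> m"
        using z Lz unfolding Z_def by auto
      show "z m \<le> n" if "d (q n) x < \<delta> m" for n
      proof (rule ccontr)
        assume "\<not> z m \<le> n"
        then have "\<not> L n z < \<delta> m"
          using z unfolding Z_def by simp
        with that Lz[of n] show False
          by simp
      qed
    qed
    then have "e x = z"
      by blast
    with x(1) show "z \<in> e ` M"
      by blast
  qed
  define c where "c m z = z m" for m and z :: baire
  have c [measurable]: "c m \<in> borel \<rightarrow>\<^sub>M count_space UNIV" for m
    unfolding c_def using measurable_baireD[OF measurable_ident] by simp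
  have L_meas [measurable]: "L n \<in> borel_measurable borel" for n
  proof -
    have "(\<lambda>z. d (q (c m z)) (q n)) \<in> borel_measurable borel" for m
      by measurable
    then show ?thesis
      unfolding L_def c_def by (rule borel_measurable_lim_metric)
  qed
  have Z_borel: "Z \<in> sets borel"
  proof -
    have [measurable]: "(\<lambda>z. L (c m z) z) \<in> borel_measurable borel" for m
      by (rule measurable_compose_countable[OF L_meas c])
    have [measurable]: "(\<lambda>z. d (q (c m z)) (q (c m' z))) \<in> borel_measurable borel" for m m'
      by (rule measurable_compose_countable[OF _ c, of "\<lambda>i z. d (q i) (q (c m' z))"]) measurable
    have "{z \<in> space borel. (\<forall>m m'. d (q (c m z)) (q (c m' z)) < \<delta> m + \<delta> m') \<and>
      (\<forall>m. L (c m z) z < \<delta> m) \<and> (\<forall>m n. n < c m z \<longrightarrow> \<not> L n z < \<delta> m)} \<in> sets borel"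
      by measurable
    then show ?thesis
      by (simp add: Z_def c_def)
  qed
  define r where "r z = (if z \<in> Z then inv_into M e z else q 0)" for z
  have r_e: "r (e x) = x" if "x \<in> M" for x
    using that Z e_inj by (auto simp: r_def)
  have "r \<in> borel \<rightarrow>\<^sub>M X"
  proof (rule measurable_sigma_sets[OF X(2)])
    show "{U. openin T U} \<subseteq> Pow M"
      using M(3) openin_subset by fastforce
    show "r \<in> space borel \<rightarrow> M"
      using Z qM inv_into_into[of _ e M] by (simp add: r_def Pi_iff)
    fix U assume "U \<in> {U. openin T U}"
    then have U: "U \<subseteq> M" "\<And>x. x \<in> U \<Longrightarrow> \<exists>\<epsilon>>0. mball x \<epsilon> \<subseteq> U"
      unfolding M(3) openin_mtopology by auto
    \<comment> \<open>The single digits that force a coded point into \<open>U\<close>. Points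
      sharing their \<open>m\<close>-th digit are less than \<open>2 * \<delta> m\<close> apart, so
      every code of a point of \<open>U\<close> has such a digit and \<open>r\<close> is continuous
      on \<open>Z\<close>.\<close>
    define I where "I = {(m, n). {x \<in> M. e x m = n} \<subseteq> U}"
    have "{z \<in> Z. r z \<in> U} = Z \<inter> (\<Union>(m, n)\<in>I. {z. z m \<in> {n}})"
    proof (intro equalityI subsetI)
      fix z assume "z \<in> {z \<in> Z. r z \<in> U}"
      then obtain x where x: "x \<in> M" "z = e x" "x \<in> U" "z \<in> Z"
        using Z r_e by auto
      obtain \<epsilon> where \<epsilon>: "0 < \<epsilon>" "mball x \<epsilon> \<subseteq> U"
        using U(2)[OF x(3)] by blast
      then have "\<forall>\<^sub>F m in sequentially. \<delta> m < \<epsilon> / 2"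
        using \<delta>_lim by (intro order_tendstoD) auto
      then obtain m where m: "\<delta> m < \<epsilon> / 2"
        by (auto simp: eventually_sequentially)
      have "{y \<in> M. e y m = e x m} \<subseteq> mball x \<epsilon>"
      proof
        fix y assume y: "y \<in> {y \<in> M. e y m = e x m}"
        then have "d x y \<le> d x (q (e x m)) + d (q (e x m)) y"
          using x(1) qM by (intro triangle) auto
        also have "\<dots> < \<delta> m + \<delta> m"
          using e_close[OF x(1), of m] e_close[of y m] y commute[of x] by (intro add_strict_mono) auto
        finally show "y \<in> mball x \<epsilon>"
          using y m x(1) by simp
      qed
      then have "(m, e x m) \<in> I"
        using \<epsilon>(2) by (auto simp: I_def)
      then show "z \<in> Z \<inter> (\<Union>(m, n)\<in>I. {z. z m \<in> {n}})"
        using x by auto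
    next
      fix z assume "z \<in> Z \<inter> (\<Union>(m, n)\<in>I. {z. z m \<in> {n}})"
      then obtain m where m: "z \<in> Z" "(m, z m) \<in> I"
        by auto
      then obtain x where "x \<in> M" "z = e x"
        using Z by blast
      with m show "z \<in> {z \<in> Z. r z \<in> U}"
        using r_e by (auto simp: I_def)
    qed
    moreover have "(\<Union>(m, n)\<in>I. {z :: baire. z m \<in> {n}}) \<in> sets borel"
      by (rule borel_open, rule open_UN) (auto intro: open_coordinate[of _ "{_}", simplified])
    ultimately have "{z \<in> Z. r z \<in> U} \<in> sets borel"
      using Z_borel by simp
    moreover have "r -` U \<inter> space borel = {z \<in> Z. r z \<in> U} \<union> (if q 0 \<in> U then - Z else {})"
      by (auto simp: r_def split: if_splits)
    moreover have "- Z \<in> sets borel"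
      using Z_borel by (rule borel_comp)
    ultimately show "r -` U \<inter> space borel \<in> sets borel"
      by auto
  qed
  with e_meas show thesis
    using r_e X(1) by (intro that) auto
qed

text \<open>Interleaving the codes of a pair turns the first projection into \<open>evens\<close>, a
  continuous self-map of Baire space, as the preceding theorems require.\<close>

definition evens :: "baire \<Rightarrow> baire" where "evens w = (\<lambda>n. w (2 * n))"
definition odds :: "baire \<Rightarrow> baire" where "odds w = (\<lambda>n. w (Suc (2 * n)))"
definition interleave :: "baire \<Rightarrow> baire \<Rightarrow> baire" where
  "interleave a b = (\<lambda>n. if even n then a (n div 2) else b (n div 2))"

lemma evens_interleave [simp]: "evens (interleave a b) = a"
  and odds_interleave [simp]: "odds (interleave a b) = b"
  by (auto simp: evens_def odds_def interleave_def)

lemma continuous_on_evens: "continuous_on S evens" and continuous_on_odds: "continuous_on S odds"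
  unfolding evens_def odds_def
  by (intro continuous_on_coordinatewise_then_product continuous_on_subset[OF continuous_on_product_coordinates],
      auto)+

lemma measurable_evens: "evens \<in> borel \<rightarrow>\<^sub>M borel" and measurable_odds: "odds \<in> borel \<rightarrow>\<^sub>M borel"
  by (intro borel_measurable_continuous_onI continuous_on_evens continuous_on_odds)+

text \<open>In coded form the fibres of \<open>evens\<close> over \<open>G\<close> are copies of the
  sections. The pieces on which \<open>evens\<close> is injective give both conclusions: their
  numbers tell the points of a section apart, and the projection of a Borel subset is a countable
  union of injective images.\<close>

theorem countable_sections_borel:
  assumes X: "standard_borel_space X" and G: "G \<in> sets (X \<Otimes>\<^sub>M X)"
    and countable: "\<And>x. x \<in> space X \<Longrightarrow> countable {y. (x, y) \<in> G}"
  obtains idx :: "'a \<times> 'a \<Rightarrow> nat" where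
    "idx \<in> X \<Otimes>\<^sub>M X \<rightarrow>\<^sub>M count_space UNIV"
    "\<forall>x. inj_on (\<lambda>y. idx (x, y)) {y. (x, y) \<in> G}"
    "\<forall>B\<in>sets (X \<Otimes>\<^sub>M X). B \<subseteq> G \<longrightarrow> fst ` B \<in> sets X"
proof (cases "space X = {}")
  case True
  then have "G = {}"
    using sets.sets_into_space[OF G] by (simp add: space_pair_measure)
  then show thesis
    by (intro that[of "\<lambda>_. 0"]) auto
next
  case False
  then obtain e :: "'a \<Rightarrow> baire" and r where e: "e \<in> X \<rightarrow>\<^sub>M borel" and r: "r \<in> borel \<rightarrow>\<^sub>M X"
    and re: "\<forall>x\<in>space X. r (e x) = x"
    using standard_borel_retract[OF X] by metis
  define E where "E p = interleave (e (fst p)) (e (snd p))" for p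
  define R where "R w = (r (evens w), r (odds w))" for w
  have e_fst: "(\<lambda>p. e (fst p)) \<in> X \<Otimes>\<^sub>M X \<rightarrow>\<^sub>M borel" and e_snd: "(\<lambda>p. e (snd p)) \<in> X \<Otimes>\<^sub>M X \<rightarrow>\<^sub>M borel"
    by (rule measurable_compose[OF measurable_fst e], rule measurable_compose[OF measurable_snd e])
  have E: "E \<in> X \<Otimes>\<^sub>M X \<rightarrow>\<^sub>M borel"
  proof (rule measurable_baireI)
    show "(\<lambda>p. E p n) \<in> X \<Otimes>\<^sub>M X \<rightarrow>\<^sub>M count_space UNIV" for n
      using measurable_baireD[OF e_fst, of "n div 2"] measurable_baireD[OF e_snd, of "n div 2"]
      by (cases "even n") (simp_all add: E_def interleave_def)
  qed
  have R: "R \<in> borel \<rightarrow>\<^sub>M X \<Otimes>\<^sub>M X"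
    unfolding R_def
    by (intro measurable_Pair measurable_compose[OF measurable_evens r] measurable_compose[OF measurable_odds r])
  have RE: "R (E p) = p" if "p \<in> space (X \<Otimes>\<^sub>M X)" for p
    using that re by (auto simp: R_def E_def space_pair_measure)
  have E_image: "E ` B \<in> sets borel" if B: "B \<in> sets (X \<Otimes>\<^sub>M X)" for B
  proof -
    \<comment> \<open>Codes are the fixed points of \<open>E \<circ> R\<close>, so the retraction
      makes images under \<open>E\<close> Borel directly.\<close>
    have "{w \<in> space borel. E (R w) = w} \<inter> (R -` B \<inter> space borel) \<in> sets borel"
      by (intro sets.Int sets_Collect_eq_baire measurable_compose[OF R E] measurable_ident measurable_sets[OF R B])
        simp
    also have "{w \<in> space borel. E (R w) = w} \<inter> (R -` B \<inter> space borel) = E ` B"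
    proof (intro equalityI subsetI)
      fix w assume "w \<in> E ` B"
      then obtain p where p: "p \<in> B" "w = E p" by blast
      then have "R w = p"
        using RE sets.sets_into_space[OF B] by blast
      with p show "w \<in> {w \<in> space borel. E (R w) = w} \<inter> (R -` B \<inter> space borel)"
        by simp
    next
      fix w assume "w \<in> {w \<in> space borel. E (R w) = w} \<inter> (R -` B \<inter> space borel)"
      then have "w = E (R w)" "R w \<in> B" by auto
      then show "w \<in> E ` B" by blast
    qed
    finally show ?thesis .
  qed
  have "countable {w \<in> E ` G. evens w = a}" for a
  proof -
    have "r a \<in> space X"
      using measurable_space[OF r] by simp
    have "{w \<in> E ` G. evens w = a} \<subseteq> (\<lambda>y. E (r a, y)) ` {y. (r a, y) \<in> G}"
    proof
      fix w assume "w \<in> {w \<in> E ` G. evens w = a}"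
      then obtain x y where xy: "(x, y) \<in> G" "w = E (x, y)" "a = e x"
        by (auto simp: E_def)
      then have "r a = x"
        using sets.sets_into_space[OF G] re by (auto simp: space_pair_measure)
      with xy show "w \<in> (\<lambda>y. E (r a, y)) ` {y. (r a, y) \<in> G}"
        by simp
    qed
    then show ?thesis
      using countable[OF \<open>r a \<in> space X\<close>] by (meson countable_image countable_subset)
  qed
  then obtain K :: "nat \<Rightarrow> baire set" where
    K: "\<forall>n. K n \<in> sets borel" "\<forall>n. inj_on evens (K n)" "E ` G = (\<Union>n. K n)"
    using lusin_novikov[OF E_image[OF G] continuous_on_evens] by metis
  define idx where "idx p = (LEAST n. E p \<in> K n)" for p
  have idx: "E p \<in> K (idx p)" if "p \<in> G" for p
    unfolding idx_def by (rule LeastI_ex) (use that K(3) in blast)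
  show thesis
  proof (rule that[of idx])
    have "(\<lambda>p. E p \<in> K n) \<in> X \<Otimes>\<^sub>M X \<rightarrow>\<^sub>M count_space UNIV" for n
      using measurable_sets[OF E, of "K n"] K(1) by (simp add: pred_def vimage_def Int_def conj_commute)
    then show "idx \<in> X \<Otimes>\<^sub>M X \<rightarrow>\<^sub>M count_space UNIV"
      unfolding idx_def by (rule measurable_Least)
    show "\<forall>x. inj_on (\<lambda>y. idx (x, y)) {y. (x, y) \<in> G}"
    proof (intro allI inj_onI)
      fix x y y' assume y: "y \<in> {y. (x, y) \<in> G}" "y' \<in> {y. (x, y) \<in> G}" "idx (x, y) = idx (x, y')"
      then have "E (x, y) \<in> K (idx (x, y))" "E (x, y') \<in> K (idx (x, y))"
        using idx by force+
      moreover have "evens (E (x, y)) = evens (E (x, y'))"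
        by (simp add: E_def)
      ultimately have "E (x, y) = E (x, y')"
        using K(2) by (blast dest: inj_onD)
      then have "R (E (x, y)) = R (E (x, y'))"
        by simp
      moreover have "(x, y) \<in> space (X \<Otimes>\<^sub>M X)" "(x, y') \<in> space (X \<Otimes>\<^sub>M X)"
        using y sets.sets_into_space[OF G] by blast+
      ultimately show "y = y'"
        by (simp add: RE)
    qed
    show "\<forall>B\<in>sets (X \<Otimes>\<^sub>M X). B \<subseteq> G \<longrightarrow> fst ` B \<in> sets X"
    proof (intro ballI impI)
      fix B assume B: "B \<in> sets (X \<Otimes>\<^sub>M X)" "B \<subseteq> G"
      have "evens ` (E ` B \<inter> K n) \<in> sets borel" for n
        using E_image[OF B(1)] K(1,2) inj_on_subset[of evens "K n" "E ` B \<inter> K n"]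
        by (intro borel_inj_image continuous_on_evens sets.Int) auto
      then have "(\<Union>n. evens ` (E ` B \<inter> K n)) \<in> sets borel"
        by blast
      also have "(\<Union>n. evens ` (E ` B \<inter> K n)) = evens ` (E ` B \<inter> E ` G)"
        unfolding K(3) by blast
      also have "E ` B \<inter> E ` G = E ` B"
        using B(2) by blast
      finally have "e -` (evens ` E ` B) \<inter> space X \<in> sets X"
        by (rule measurable_sets[OF e])
      also have "e -` (evens ` E ` B) \<inter> space X = fst ` B"
      proof (intro equalityI subsetI)
        fix x assume "x \<in> e -` (evens ` E ` B) \<inter> space X"
        then obtain p where p: "x \<in> space X" "p \<in> B" "e x = e (fst p)"
          by (auto simp: E_def)
        moreover have "fst p \<in> space X"
          using p(2) sets.sets_into_space[OF B(1)] by (auto simp: space_pair_measure)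
        ultimately have "x = fst p"
          using re by metis
        with p(2) show "x \<in> fst ` B"
          by blast
      next
        fix x assume "x \<in> fst ` B"
        then obtain p where "p \<in> B" "x = fst p" by blast
        moreover from this have "evens (E p) = e x" "x \<in> space X"
          using sets.sets_into_space[OF B(1)] by (auto simp: E_def space_pair_measure)
        ultimately show "x \<in> e -` (evens ` E ` B) \<inter> space X"
          by (metis IntI image_eqI vimageI)
      qed
      finally show "fst ` B \<in> sets X" .
    qed
  qed
qed

section \<open>Generic labels\<close>

text \<open>The labels are assigned to the colours in consecutive blocks, the \<open>t\<close>-th block being long enough
  to pass the \<open>t\<close>-th test.\<close>

lemma exists_generic_labels:
  fixes M :: "'a measure" and \<T> :: "nat \<Rightarrow> 'a set set" and H :: "'j :: countable \<Rightarrow> nat \<Rightarrow> 'a set"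
  assumes large: "\<And>i A. range A \<subseteq> sets M \<Longrightarrow> incseq A \<Longrightarrow> (\<Union>n. A n) = space M \<Longrightarrow> \<exists>n::nat. A n \<in> \<T> i"
    and mono: "\<And>i A B. A \<in> \<T> i \<Longrightarrow> A \<subseteq> B \<Longrightarrow> B \<in> sets M \<Longrightarrow> B \<in> \<T> i"
    and H: "\<And>j n. H j n \<in> sets M"
    and inf: "\<And>j x. x \<in> space M \<Longrightarrow> infinite {n. x \<in> H j n}"
  shows "\<exists>p :: nat \<Rightarrow> nat. \<forall>j k i. (\<Union>n\<in>{n. p n = k}. H j n) \<in> \<T> i"
proof -
  \<comment> \<open>The \<open>t\<close>-th block handles the \<open>t\<close>-th triple: its
    colours all receive label \<open>k t\<close>, and the points they serve for \<open>j t\<close>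
    must pass test \<open>i t\<close>.\<close>
  define j k i where "j t = fst (from_nat t :: 'j \<times> nat \<times> nat)"
    and "k t = fst (snd (from_nat t :: 'j \<times> nat \<times> nat))"
    and "i t = snd (snd (from_nat t :: 'j \<times> nat \<times> nat))" for t :: nat
  have step: "\<exists>b\<ge>a. (\<Union>n\<in>{a..<b}. H (j t) n) \<in> \<T> (i t)" for a t
  proof -
    define A where "A b = (\<Union>n\<in>{a..<a + b}. H (j t) n)" for b
    have "A b \<in> sets M" for b
      using H unfolding A_def by auto
    moreover have "incseq A"
      unfolding A_def by (intro monoI UN_mono) auto
    moreover have "(\<Union>b. A b) = space M"
    proof (intro equalityI subsetI)
      fix x assume "x \<in> (\<Union>b. A b)"
      then show "x \<in> space M"
        using sets.sets_into_space[OF H] by (auto simp: A_def)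
    next
      fix x assume "x \<in> space M"
      then obtain n where "a \<le> n" "x \<in> H (j t) n"
        using inf[of x "j t"] by (metis (mono_tags, lifting) infinite_nat_iff_unbounded_le mem_Collect_eq)
      then have "x \<in> A (Suc (n - a))"
        by (auto simp: A_def)
      then show "x \<in> (\<Union>b. A b)"
        by blast
    qed
    ultimately obtain b where "A b \<in> \<T> (i t)"
      using large[of A "i t"] by blast
    then show ?thesis
      unfolding A_def by (intro exI[of _ "a + b"]) simp
  qed
  have "\<exists>N. \<forall>t. True \<and> (N t \<le> N (Suc t) \<and> (\<Union>n\<in>{N t..<N (Suc t)}. H (j t) n) \<in> \<T> (i t))"
    by (rule dependent_nat_choice) (use step in auto)
  then obtain N where N: "\<And>t. N t \<le> N (Suc t)" "\<And>t. (\<Union>n\<in>{N t..<N (Suc t)}. H (j t) n) \<in> \<T> (i t)"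
    by blast
  \<comment> \<open>The label of the block containing \<open>n\<close>. Should \<open>N\<close> be
    bounded, colours beyond all blocks get an unspecified but fixed label, which can only enlarge
    the unions considered.\<close>
  define p where "p n = k (LEAST t. n < N (Suc t))" for n
  have p: "p n = k t" if "n \<in> {N t..<N (Suc t)}" for n t
  proof -
    have "(LEAST s. n < N (Suc s)) = t"
    proof (rule Least_equality)
      show "n < N (Suc t)"
        using that by simp
      show "t \<le> s" if s: "n < N (Suc s)" for s
      proof (rule ccontr)
        assume "\<not> t \<le> s"
        then have "N (Suc s) \<le> N t"
          by (intro lift_Suc_mono_le[of N, OF N(1)]) simp
        then show False
          using s \<open>n \<in> {N t..<N (Suc t)}\<close> by simp
      qed
    qed
    then show ?thesis
      by (simp add: p_def)
  qed
  have "(\<Union>n\<in>{n. p n = k0}. H j0 n) \<in> \<T> i0" for j0 k0 i0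
  proof -
    define t where "t = to_nat (j0, k0, i0)"
    have t: "j t = j0" "k t = k0" "i t = i0"
      by (simp_all add: t_def j_def k_def i_def)
    show ?thesis
    proof (rule mono)
      show "(\<Union>n\<in>{N t..<N (Suc t)}. H j0 n) \<in> \<T> i0"
        using N(2)[of t] t by simp
      show "(\<Union>n\<in>{N t..<N (Suc t)}. H j0 n) \<subseteq> (\<Union>n\<in>{n. p n = k0}. H j0 n)"
        by (intro UN_mono subsetI) (use p[of _ t] t in auto)
      show "(\<Union>n\<in>{n. p n = k0}. H j0 n) \<in> sets M"
        using H by auto
    qed
  qed
  then show ?thesis
    by blast
qed

section \<open>Walks and edge colourings\<close>

text \<open>A code lists the \<open>idx\<close> values of successive edges. With \<open>idx\<close>
  injective on each neighbourhood it has at most one end, so countably many partial functions reach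
  everything in a component.\<close>

primrec walk :: "('a \<times> 'a) set \<Rightarrow> ('a \<times> 'a \<Rightarrow> nat) \<Rightarrow> nat list \<Rightarrow> 'a \<Rightarrow> 'a \<Rightarrow> bool" where
  "walk G idx [] x y \<longleftrightarrow> x = y"
| "walk G idx (j # \<gamma>) x y \<longleftrightarrow> (\<exists>w. (x, w) \<in> G \<and> idx (x, w) = j \<and> walk G idx \<gamma> w y)"

lemma walk_append: "walk G idx (\<gamma> @ \<gamma>') x z \<longleftrightarrow> (\<exists>y. walk G idx \<gamma> x y \<and> walk G idx \<gamma>' y z)"
  by (induction \<gamma> arbitrary: x) auto

lemma walk_unique:
  assumes "\<forall>x. inj_on (\<lambda>y. idx (x, y)) {y. (x, y) \<in> G}"
  shows "walk G idx \<gamma> x y \<Longrightarrow> walk G idx \<gamma> x y' \<Longrightarrow> y = y'"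
proof (induction \<gamma> arbitrary: x)
  case (Cons j \<gamma>)
  from Cons.prems obtain w w' where w: "(x, w) \<in> G" "idx (x, w) = j" "walk G idx \<gamma> w y"
      "(x, w') \<in> G" "idx (x, w') = j" "walk G idx \<gamma> w' y'"
    by auto
  then have "w = w'"
    using inj_onD[OF spec[OF assms, of x], of w w'] by simp
  with w Cons.IH show ?case
    by blast
qed simp

lemma rtrancl_imp_walk:
  assumes "(x, y) \<in> G\<^sup>*"
  shows "\<exists>\<gamma>. walk G idx \<gamma> x y"
  using assms
proof (induction rule: converse_rtrancl_induct)
  case base
  have "walk G idx [] y y" by simp
  then show ?case ..
next
  case (step x w)
  then obtain \<gamma> where "walk G idx \<gamma> w y" by blast
  with step have "walk G idx (idx (x, w) # \<gamma>) x y" by auto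
  then show ?case ..
qed

lemma walk_in_space:
  assumes "G \<subseteq> space X \<times> space X" "x \<in> space X" "walk G idx \<gamma> x y"
  shows "y \<in> space X"
  using assms(2,3)
proof (induction \<gamma> arbitrary: x)
  case (Cons j \<gamma>)
  then show ?case
    using assms(1) by auto
qed simp

text \<open>The first edges with index \<open>j\<close> that lead into a Borel set form a Borel
  subset of \<open>G\<close>, whose projection is Borel because sections are countable.\<close>

lemma sets_walk:
  assumes G: "G \<in> sets (X \<Otimes>\<^sub>M X)" and idx: "idx \<in> X \<Otimes>\<^sub>M X \<rightarrow>\<^sub>M count_space UNIV"
    and fst: "\<forall>B\<in>sets (X \<Otimes>\<^sub>M X). B \<subseteq> G \<longrightarrow> fst ` B \<in> sets X"
    and D: "D \<in> sets X"
  shows "{x \<in> space X. \<exists>y\<in>D. walk G idx \<gamma> x y} \<in> sets X"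
proof (induction \<gamma>)
  case Nil
  have "{x \<in> space X. \<exists>y\<in>D. walk G idx [] x y} = D"
    using sets.sets_into_space[OF D] by auto
  then show ?case
    using D by simp
next
  case (Cons j \<gamma>)
  let ?W = "{x \<in> space X. \<exists>y\<in>D. walk G idx \<gamma> x y}"
  have GX: "G \<subseteq> space X \<times> space X"
    using sets.sets_into_space[OF G] by (simp add: space_pair_measure)
  have 1: "idx -` {j} \<inter> space (X \<Otimes>\<^sub>M X) \<in> sets (X \<Otimes>\<^sub>M X)"
    by (rule measurable_sets[OF idx]) simp
  have 2: "space X \<times> ?W \<in> sets (X \<Otimes>\<^sub>M X)"
    using Cons by simp
  have "G \<inter> (idx -` {j} \<inter> space (X \<Otimes>\<^sub>M X)) \<inter> (space X \<times> ?W) \<in> sets (X \<Otimes>\<^sub>M X)"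
    by (rule sets.Int[OF sets.Int[OF G 1] 2])
  then have "fst ` (G \<inter> (idx -` {j} \<inter> space (X \<Otimes>\<^sub>M X)) \<inter> (space X \<times> ?W)) \<in> sets X"
    by (rule fst[rule_format]) blast
  also have "fst ` (G \<inter> (idx -` {j} \<inter> space (X \<Otimes>\<^sub>M X)) \<inter> (space X \<times> ?W)) =
      {x \<in> space X. \<exists>y\<in>D. walk G idx (j # \<gamma>) x y}"
  proof (intro equalityI subsetI)
    fix x assume "x \<in> fst ` (G \<inter> (idx -` {j} \<inter> space (X \<Otimes>\<^sub>M X)) \<inter> (space X \<times> ?W))"
    then obtain w y where "x \<in> space X" "(x, w) \<in> G" "idx (x, w) = j" "y \<in> D" "walk G idx \<gamma> w y"
      by auto
    then show "x \<in> {x \<in> space X. \<exists>y\<in>D. walk G idx (j # \<gamma>) x y}"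
      by (simp, blast)
  next
    fix x assume "x \<in> {x \<in> space X. \<exists>y\<in>D. walk G idx (j # \<gamma>) x y}"
    then obtain w y where "(x, w) \<in> G" "idx (x, w) = j" "y \<in> D" "walk G idx \<gamma> w y"
      by auto
    with GX show "x \<in> fst ` (G \<inter> (idx -` {j} \<inter> space (X \<Otimes>\<^sub>M X)) \<inter> (space X \<times> ?W))"
      by (intro image_eqI[of _ _ "(x, w)"]) (auto simp: space_pair_measure)
  qed
  finally show ?case .
qed

text \<open>The colour codes the unordered pair of the indices of an edge in its two directions. It
  leaves at most two possibilities for the index at \<open>v\<close>, so finitely many colours at
  \<open>v\<close> would mean finitely many neighbours.\<close>

theorem borel_edge_colouring:
  assumes X: "standard_borel_space X" and G: "borel_graph X G" and reg: "aleph0_regular X G"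
  obtains idx col :: "'a \<times> 'a \<Rightarrow> nat" where
    "idx \<in> X \<Otimes>\<^sub>M X \<rightarrow>\<^sub>M count_space UNIV"
    "\<forall>x. inj_on (\<lambda>y. idx (x, y)) {y. (x, y) \<in> G}"
    "\<forall>B\<in>sets (X \<Otimes>\<^sub>M X). B \<subseteq> G \<longrightarrow> fst ` B \<in> sets X"
    "col \<in> X \<Otimes>\<^sub>M X \<rightarrow>\<^sub>M count_space UNIV"
    "\<forall>v w. col (v, w) = col (w, v)"
    "\<forall>v\<in>space X. infinite {n. \<exists>w. (v, w) \<in> G \<and> col (v, w) = n}"
proof -
  have Gs: "G \<in> sets (X \<Otimes>\<^sub>M X)"
    using G by (simp add: borel_graph_def)
  have GX: "G \<subseteq> space X \<times> space X"
    using sets.sets_into_space[OF Gs] by (simp add: space_pair_measure)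
  have nbhd: "{y. (x, y) \<in> G} \<approx> (UNIV :: nat set)" if "x \<in> space X" for x
  proof -
    have "{y. (x, y) \<in> G} = nbhd X G x"
      using GX by (auto simp: nbhd_def)
    then show ?thesis
      using reg that by (simp add: aleph0_regular_def)
  qed
  have "countable {y. (x, y) \<in> G}" if "x \<in> space X" for x
    using nbhd[OF that] by (meson countableI_type countable_eqpoll eqpoll_sym)
  from countable_sections_borel[OF X Gs this] obtain idx :: "'a \<times> 'a \<Rightarrow> nat" where
    idx: "idx \<in> X \<Otimes>\<^sub>M X \<rightarrow>\<^sub>M count_space UNIV" "\<forall>x. inj_on (\<lambda>y. idx (x, y)) {y. (x, y) \<in> G}"
      "\<forall>B\<in>sets (X \<Otimes>\<^sub>M X). B \<subseteq> G \<longrightarrow> fst ` B \<in> sets X"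
    by metis
  define idx' where "idx' p = idx (case p of (x, y) \<Rightarrow> (y, x))" for p
  have idx': "idx' \<in> X \<Otimes>\<^sub>M X \<rightarrow>\<^sub>M count_space UNIV"
    unfolding idx'_def by (rule measurable_compose[OF measurable_pair_swap' idx(1)])
  define col where "col p = prod_encode (min (idx p) (idx' p), max (idx p) (idx' p))" for p
  have "infinite {n. \<exists>w. (v, w) \<in> G \<and> col (v, w) = n}" if v: "v \<in> space X" for v
  proof
    assume fin: "finite {n. \<exists>w. (v, w) \<in> G \<and> col (v, w) = n}"
    have "(\<lambda>y. idx (v, y)) ` {y. (v, y) \<in> G} \<subseteq>
        (\<Union>n\<in>{n. \<exists>w. (v, w) \<in> G \<and> col (v, w) = n}. {fst (prod_decode n), snd (prod_decode n)})"
    proof (rule image_subsetI)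
      fix y assume "y \<in> {y. (v, y) \<in> G}"
      then show "idx (v, y) \<in> (\<Union>n\<in>{n. \<exists>w. (v, w) \<in> G \<and> col (v, w) = n}. {fst (prod_decode n), snd (prod_decode n)})"
        by (intro UN_I[of "col (v, y)"]) (auto simp: col_def min_def max_def)
    qed
    then have "finite ((\<lambda>y. idx (v, y)) ` {y. (v, y) \<in> G})"
      by (rule finite_subset) (use fin in auto)
    then have "finite {y. (v, y) \<in> G}"
      using idx(2) by (blast dest: finite_imageD)
    then show False
      using nbhd[OF v] eqpoll_finite_iff by auto
  qed
  moreover have "col \<in> X \<Otimes>\<^sub>M X \<rightarrow>\<^sub>M count_space UNIV"
  proof -
    have "(\<lambda>p. prod_encode (min i (idx' p), max i (idx' p))) \<in> X \<Otimes>\<^sub>M X \<rightarrow>\<^sub>M count_space UNIV" for i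
      by (rule measurable_compose[OF idx']) simp
    from measurable_compose_countable[OF this idx(1)] show ?thesis
      unfolding col_def .
  qed
  moreover have "col (v, w) = col (w, v)" for v w
    by (simp add: col_def idx'_def min.commute max.commute)
  ultimately show thesis
    using that[OF idx] by blast
qed

theorem generic_domatic_labelling:
  fixes \<T> :: "nat \<Rightarrow> 'a set set"
  assumes X: "standard_borel_space X" and G: "borel_graph X G" and reg: "aleph0_regular X G"
    and large: "\<And>i A. range A \<subseteq> sets X \<Longrightarrow> incseq A \<Longrightarrow> (\<Union>n. A n) = space X \<Longrightarrow> \<exists>n::nat. A n \<in> \<T> i"
    and mono: "\<And>i A B. A \<in> \<T> i \<Longrightarrow> A \<subseteq> B \<Longrightarrow> B \<in> sets X \<Longrightarrow> B \<in> \<T> i"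
  obtains B :: "nat \<Rightarrow> 'a set" and f where "\<forall>m. B m \<in> sets X" "\<forall>m i. B m \<in> \<T> i"
    "invariant_set X G (\<Inter>m. B m)" "borel_labelling X G (\<Inter>m. B m) f"
    "symmetric_labelling G (\<Inter>m. B m) f" "\<forall>v\<in>(\<Inter>m. B m). domatic_at X G f v"
proof -
  have Gs: "G \<in> sets (X \<Otimes>\<^sub>M X)"
    using G by (simp add: borel_graph_def)
  have GX: "G \<subseteq> space X \<times> space X"
    using sets.sets_into_space[OF Gs] by (simp add: space_pair_measure)
  obtain idx col :: "'a \<times> 'a \<Rightarrow> nat" where
    idx: "idx \<in> X \<Otimes>\<^sub>M X \<rightarrow>\<^sub>M count_space UNIV" "\<forall>x. inj_on (\<lambda>y. idx (x, y)) {y. (x, y) \<in> G}"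
      "\<forall>B\<in>sets (X \<Otimes>\<^sub>M X). B \<subseteq> G \<longrightarrow> fst ` B \<in> sets X"
    and col: "col \<in> X \<Otimes>\<^sub>M X \<rightarrow>\<^sub>M count_space UNIV" "\<forall>v w. col (v, w) = col (w, v)"
      "\<forall>v\<in>space X. infinite {n. \<exists>w. (v, w) \<in> G \<and> col (v, w) = n}"
    by (rule borel_edge_colouring[OF X G reg])
  define S where "S n = {v \<in> space X. \<exists>w. (v, w) \<in> G \<and> col (v, w) = n}" for n
  have S: "S n \<in> sets X" for n
  proof -
    have "G \<inter> (col -` {n} \<inter> space (X \<Otimes>\<^sub>M X)) \<in> sets (X \<Otimes>\<^sub>M X)"
      by (rule sets.Int[OF Gs measurable_sets[OF col(1)]]) simp
    then have "fst ` (G \<inter> (col -` {n} \<inter> space (X \<Otimes>\<^sub>M X))) \<in> sets X"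
      by (rule idx(3)[rule_format]) blast
    also have "fst ` (G \<inter> (col -` {n} \<inter> space (X \<Otimes>\<^sub>M X))) = S n"
      using GX by (force simp: S_def space_pair_measure)
    finally show ?thesis .
  qed
  \<comment> \<open>Vertices from which \<open>\<gamma>\<close> cannot be followed belong to every
    \<open>H \<gamma> n\<close>. This keeps the exhaustion of all of \<open>X\<close>
    intact.\<close>
  define H where "H \<gamma> n = {x \<in> space X. \<forall>y. walk G idx \<gamma> x y \<longrightarrow> y \<in> S n}" for \<gamma> n
  have H: "H \<gamma> n \<in> sets X" for \<gamma> n
  proof -
    have "space X - {x \<in> space X. \<exists>y\<in>space X - S n. walk G idx \<gamma> x y} \<in> sets X"
      using S by (intro sets.Diff sets.top sets_walk[OF Gs idx(1,3)])
    also have "space X - {x \<in> space X. \<exists>y\<in>space X - S n. walk G idx \<gamma> x y} = H \<gamma> n"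
      using walk_in_space[OF GX] by (auto simp: H_def)
    finally show ?thesis .
  qed
  have H_inf: "infinite {n. x \<in> H \<gamma> n}" if x: "x \<in> space X" for \<gamma> x
  proof (cases "\<exists>y. walk G idx \<gamma> x y")
    case True
    then obtain y where y: "walk G idx \<gamma> x y" by blast
    then have "y \<in> space X"
      by (rule walk_in_space[OF GX x])
    moreover have "{n. \<exists>w. (y, w) \<in> G \<and> col (y, w) = n} \<subseteq> {n. x \<in> H \<gamma> n}"
      using walk_unique[OF idx(2) y] x \<open>y \<in> space X\<close> by (auto simp: H_def S_def)
    ultimately show ?thesis
      using col(3) finite_subset by blast
  next
    case False
    then have "{n. x \<in> H \<gamma> n} = UNIV"
      using x by (auto simp: H_def)
    then show ?thesis
      by simp
  qed
  have "\<exists>p :: nat \<Rightarrow> nat. \<forall>\<gamma> k i. (\<Union>n\<in>{n. p n = k}. H \<gamma> n) \<in> \<T> i"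
    by (rule exists_generic_labels[of X \<T> H]) (rule large mono H H_inf; assumption)+
  then obtain p :: "nat \<Rightarrow> nat" where p: "\<forall>\<gamma> k i. (\<Union>n\<in>{n. p n = k}. H \<gamma> n) \<in> \<T> i" ..
  define B where "B m = (case from_nat m of (\<gamma> :: nat list, k) \<Rightarrow> \<Union>n\<in>{n. p n = k}. H \<gamma> n)" for m
  define C where "C = (\<Inter>m. B m)"
  have C: "x \<in> C \<longleftrightarrow> (\<forall>\<gamma> k. \<exists>n. p n = k \<and> x \<in> H \<gamma> n)" for x
  proof -
    have "x \<in> C \<longleftrightarrow> (\<forall>a. x \<in> (case a of (\<gamma> :: nat list, k) \<Rightarrow> \<Union>n\<in>{n. p n = k}. H \<gamma> n))"
      unfolding C_def B_def by (metis (no_types, lifting) INT_iff UNIV_I from_nat_to_nat)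
    then show ?thesis
      by auto
  qed
  have CX: "C \<subseteq> space X"
    using C by (auto simp: H_def)
  \<comment> \<open>If \<open>\<gamma>\<close> leads from \<open>x\<close> to \<open>y\<close>, then
    the requirement for \<open>\<gamma>'\<close> at \<open>y\<close> follows from the one for
    \<open>\<gamma> @ \<gamma>'\<close> at \<open>x\<close>.\<close>
  have invariant: "y \<in> C" if x: "x \<in> C" and xy: "(x, y) \<in> G\<^sup>*" for x y
    unfolding C
  proof (intro allI)
    fix \<gamma>' k
    obtain \<gamma> where \<gamma>: "walk G idx \<gamma> x y"
      using rtrancl_imp_walk[OF xy] by blast
    obtain n where n: "p n = k" "x \<in> H (\<gamma> @ \<gamma>') n"
      using x unfolding C by blast
    have "y \<in> space X"
      using walk_in_space[OF GX _ \<gamma>] CX x by blast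
    moreover have "z \<in> S n" if "walk G idx \<gamma>' y z" for z
      using n(2) that \<gamma> walk_append[of G idx \<gamma> \<gamma>' x z] unfolding H_def by blast
    ultimately show "\<exists>n. p n = k \<and> y \<in> H \<gamma>' n"
      using n(1) unfolding H_def by blast
  qed
  define f where "f = (\<lambda>e. p (col e))"
  show thesis
  proof (rule that[of B f]; (unfold C_def[symmetric])?)
    show "\<forall>m. B m \<in> sets X"
      using H by (auto simp: B_def split: prod.split)
    show "\<forall>m i. B m \<in> \<T> i"
      using p by (auto simp: B_def split: prod.split)
    show "invariant_set X G C"
      unfolding invariant_set_def
    proof (intro exI[of _ "(\<lambda>x. conn_rel X G `` {x}) ` C"] conjI)
      show "(\<lambda>x. conn_rel X G `` {x}) ` C \<subseteq> space X // conn_rel X G"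
        using CX by (auto intro: quotientI)
      show "C = \<Union> ((\<lambda>x. conn_rel X G `` {x}) ` C)"
        using CX invariant by (auto simp: conn_rel_def)
    qed
    have "f \<in> X \<Otimes>\<^sub>M X \<rightarrow>\<^sub>M count_space UNIV"
      unfolding f_def by (rule measurable_compose[OF col(1)]) simp
    then show "borel_labelling X G C f"
      unfolding borel_labelling_def by (rule measurable_restrict_space1)
    show "symmetric_labelling G C f"
      using col(2) by (auto simp: symmetric_labelling_def f_def)
    show "\<forall>v\<in>C. domatic_at X G f v"
      unfolding domatic_at_def
    proof (intro ballI allI)
      fix v k assume "v \<in> C"
      then obtain n where n: "p n = k" "v \<in> H [] n"
        unfolding C by blast
      then obtain w where "(v, w) \<in> G" "col (v, w) = n"
        by (auto simp: H_def S_def)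
      moreover from this have "col (w, v) = n"
        using col(2) by metis
      ultimately show "\<exists>w\<in>nbhd X G v. f (v, w) = k \<and> f (w, v) = k"
        using n(1) GX by (auto simp: nbhd_def f_def)
    qed
  qed
qed

section \<open>Measure and category\<close>

lemma nowhere_dense_in_subset:
  assumes "nowhere_dense_in T N" "A \<subseteq> N"
  shows "nowhere_dense_in T A"
proof -
  have "T interior_of (T closure_of A) \<subseteq> T interior_of (T closure_of N)"
    by (intro interior_of_mono closure_of_mono assms)
  then show ?thesis
    using assms unfolding nowhere_dense_in_def by blast
qed

lemma meager_in_subset:
  assumes "meager_in T A" "B \<subseteq> A"
  shows "meager_in T B"
proof -
  obtain \<N> where \<N>: "countable \<N>" "\<forall>N\<in>\<N>. nowhere_dense_in T N" "A = \<Union>\<N>"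
    using assms(1) unfolding meager_in_def by blast
  have "B = \<Union>((\<lambda>N. N \<inter> B) ` \<N>)"
    using assms(2) \<N>(3) by blast
  moreover have "\<forall>N\<in>(\<lambda>N. N \<inter> B) ` \<N>. nowhere_dense_in T N"
    using \<N>(2) by (auto intro: nowhere_dense_in_subset)
  ultimately show ?thesis
    unfolding meager_in_def using \<N>(1) by blast
qed

lemma meager_in_UN:
  fixes A :: "nat \<Rightarrow> 'a set"
  assumes "\<And>n. meager_in T (A n)"
  shows "meager_in T (\<Union>n. A n)"
proof -
  have "\<forall>n. \<exists>\<N>. countable \<N> \<and> (\<forall>N\<in>\<N>. nowhere_dense_in T N) \<and> A n = \<Union>\<N>"
    using assms unfolding meager_in_def by blast
  from choice[OF this] obtain \<N> where
    \<N>: "\<forall>n. countable (\<N> n) \<and> (\<forall>N\<in>\<N> n. nowhere_dense_in T N) \<and> A n = \<Union>(\<N> n)" ..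
  have "countable (\<Union>n. \<N> n)"
    using \<N> by (intro countable_UN) auto
  moreover have "\<forall>N\<in>(\<Union>n. \<N> n). nowhere_dense_in T N"
    using \<N> by simp
  moreover have "A n = \<Union>(\<N> n)" for n
    using \<N> by simp
  then have "(\<Union>n. A n) = \<Union>(\<Union>n. \<N> n)"
    by blast
  ultimately show ?thesis
    unfolding meager_in_def by blast
qed

lemma meager_in_empty: "meager_in T {}"
  unfolding meager_in_def by (intro exI[of _ "{}"]) simp

lemma meager_in_Un:
  assumes "meager_in T A" "meager_in T B"
  shows "meager_in T (A \<union> B)"
proof -
  have "meager_in T (\<Union>n::nat. if n = 0 then A else B)"
    by (rule meager_in_UN) (use assms in auto)
  then show ?thesis
    by (rule meager_in_subset) (auto split: if_splits)
qed

lemma meager_in_frontier: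
  assumes "openin T U"
  shows "meager_in T (T closure_of U - U)"
proof -
  have closed: "closedin T (T closure_of U - U)"
    by (intro closedin_diff assms) simp
  have "T interior_of (T closure_of U - U) = {}"
  proof (rule ccontr)
    assume "T interior_of (T closure_of U - U) \<noteq> {}"
    then obtain x where x: "x \<in> T interior_of (T closure_of U - U)" by blast
    have sub: "T interior_of (T closure_of U - U) \<subseteq> T closure_of U - U"
      by (rule interior_of_subset)
    then have "x \<in> T closure_of U"
      using x by blast
    then obtain y where "y \<in> U" "y \<in> T interior_of (T closure_of U - U)"
      using x openin_interior_of[of T "T closure_of U - U"] unfolding in_closure_of by blast
    with sub show False
      by blast
  qed
  then have "nowhere_dense_in T (T closure_of U - U)"
    unfolding nowhere_dense_in_def using closed closedin_subset[OF closed] closure_of_closedin by metis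
  then show ?thesis
    unfolding meager_in_def by (intro exI[of _ "{T closure_of U - U}"]) simp
qed

lemma nonempty_open_not_meager:
  assumes "completely_metrizable_space T" "openin T U" "U \<noteq> {}"
  shows "\<not> meager_in T U"
proof
  assume "meager_in T U"
  then obtain \<N> where \<N>: "countable \<N>" "\<forall>N\<in>\<N>. nowhere_dense_in T N" "U = \<Union>\<N>"
    unfolding meager_in_def by blast
  have "T interior_of \<Union>((\<lambda>N. T closure_of N) ` \<N>) = {}"
    by (rule Baire_category_alt) (use assms(1) \<N> in \<open>auto simp: nowhere_dense_in_def\<close>)
  moreover have "U \<subseteq> \<Union>((\<lambda>N. T closure_of N) ` \<N>)"
  proof
    fix x assume "x \<in> U"
    then obtain N where N: "N \<in> \<N>" "x \<in> N"
      using \<N>(3) by blast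
    then have "N \<subseteq> T closure_of N"
      using \<N>(2) by (intro closure_of_subset) (simp add: nowhere_dense_in_def)
    with N show "x \<in> \<Union>((\<lambda>N. T closure_of N) ` \<N>)"
      by blast
  qed
  then have "U \<subseteq> T interior_of \<Union>((\<lambda>N. T closure_of N) ` \<N>)"
    using assms(2) by (rule interior_of_maximal)
  ultimately show False
    using assms(3) by blast
qed

text \<open>For a complement, \<open>U\<close> is replaced by the complement of its closure, at the
  cost of the meager frontier of \<open>U\<close>.\<close>

lemma borel_baire_property:
  assumes "A \<in> sigma_sets (topspace T) {U. openin T U}"
  shows "\<exists>U. openin T U \<and> meager_in T (A - U) \<and> meager_in T (U - A)"
  using assms
proof induction
  case (Basic A)
  then show ?case
    by (intro exI[of _ A]) (simp add: meager_in_empty)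
next
  case Empty
  show ?case
    by (intro exI[of _ "{}"]) (simp add: meager_in_empty)
next
  case (Compl A)
  then obtain U where U: "openin T U" "meager_in T (A - U)" "meager_in T (U - A)"
    by blast
  have "meager_in T ((topspace T - A) - (topspace T - T closure_of U))"
    by (rule meager_in_subset[OF meager_in_Un[OF meager_in_frontier[OF U(1)] U(3)]]) blast
  moreover have "U \<subseteq> T closure_of U"
    using openin_subset[OF U(1)] by (rule closure_of_subset)
  then have "meager_in T ((topspace T - T closure_of U) - (topspace T - A))"
    by (intro meager_in_subset[OF U(2)]) blast
  moreover have "openin T (topspace T - T closure_of U)"
    by (rule openin_diff[OF openin_topspace closedin_closure_of])
  ultimately show ?case
    by blast
next
  case (Union A)
  from choice[OF allI[OF Union.IH]] obtain U where
    U: "\<forall>n. openin T (U n) \<and> meager_in T (A n - U n) \<and> meager_in T (U n - A n)" ..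
  have "openin T (\<Union>n. U n)"
    using U by auto
  moreover have "meager_in T (\<Union>n. A n - U n)"
    using U by (intro meager_in_UN) simp
  then have "meager_in T ((\<Union>n. A n) - (\<Union>n. U n))"
    by (rule meager_in_subset) blast
  moreover have "meager_in T (\<Union>n. U n - A n)"
    using U by (intro meager_in_UN) simp
  then have "meager_in T ((\<Union>n. U n) - (\<Union>n. A n))"
    by (rule meager_in_subset) blast
  ultimately show ?case
    by blast
qed

lemma polish_pi_base:
  assumes "polish_topology_on X T"
  obtains V :: "nat \<Rightarrow> 'a set" where "\<forall>i. openin T (V i)"
    "\<forall>U. openin T U \<and> U \<noteq> {} \<longrightarrow> (\<exists>i. V i \<noteq> {} \<and> V i \<subseteq> U)"
proof (cases "space X = {}")
  case True
  then have "topspace T = {}"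
    using assms unfolding polish_topology_on_def by simp
  then show thesis
    using openin_subset[of T] by (intro that[of "\<lambda>_. {}"]) auto
next
  case False
  obtain M d q where M: "Metric_space M d" "T = Metric_space.mtopology M d" "range q \<subseteq> M"
      and dense: "\<And>x r. x \<in> M \<Longrightarrow> 0 < r \<Longrightarrow> \<exists>n::nat. d (q n) x < r"
    using polish_topology_onE[OF assms False] by metis
  interpret Metric_space M d
    by (rule M(1))
  define V where "V i = mball (q (fst (prod_decode i))) (1 / real (Suc (snd (prod_decode i))))" for i
  have "\<exists>i. V i \<noteq> {} \<and> V i \<subseteq> U" if U: "openin T U \<and> U \<noteq> {}" for U
  proof -
    obtain x where x: "x \<in> U" "x \<in> M"
      using U M(2) openin_subset by fastforce
    then obtain \<epsilon> where \<epsilon>: "0 < \<epsilon>" "mball x \<epsilon> \<subseteq> U"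
      using U unfolding M(2) openin_mtopology by blast
    obtain m where m: "1 / real (Suc m) < \<epsilon> / 2"
      using reals_Archimedean[of "\<epsilon> / 2"] \<epsilon>(1) by (auto simp: inverse_eq_divide)
    obtain n where n: "d (q n) x < 1 / real (Suc m)"
      using dense[OF x(2), of "1 / real (Suc m)"] by auto
    have qM: "q n \<in> M"
      using M(3) by blast
    have "mball (q n) (1 / real (Suc m)) \<subseteq> mball x \<epsilon>"
    proof
      fix y assume y: "y \<in> mball (q n) (1 / real (Suc m))"
      then have "d x y \<le> d x (q n) + d (q n) y"
        using x(2) qM by (intro triangle) simp_all
      also have "\<dots> < \<epsilon>"
        using y n m commute[of x "q n"] by simp
      finally show "y \<in> mball x \<epsilon>"
        using x(2) y by simp
    qed
    moreover have "q n \<in> mball (q n) (1 / real (Suc m))"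
      using qM by simp
    moreover have "V (prod_encode (n, m)) = mball (q n) (1 / real (Suc m))"
      by (simp add: V_def)
    ultimately have "V (prod_encode (n, m)) \<noteq> {}" "V (prod_encode (n, m)) \<subseteq> U"
      using \<epsilon>(2) by blast+
    then show ?thesis
      by blast
  qed
  then show thesis
    by (intro that[of V]) (auto simp: V_def M(2))
qed

theorem domatic_labelling_conull:
  assumes X: "standard_borel_space X" and G: "borel_graph X G" and reg: "aleph0_regular X G"
    and "prob_space \<mu>" and sets: "sets \<mu> = sets X"
  shows "\<exists>C f. C \<in> sets X \<and> invariant_set X G C \<and> conull \<mu> C \<and> borel_labelling X G C f \<and>
    symmetric_labelling G C f \<and> (\<forall>v\<in>C. domatic_at X G f v)"
proof -
  interpret prob_space \<mu>
    by fact
  have space: "space \<mu> = space X"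
    using sets by (rule sets_eq_imp_space_eq)
  \<comment> \<open>Continuity from below passes each of these tests along an exhaustion; passing
    all of them means measure 1.\<close>
  define \<T> where "\<T> i = {A \<in> sets X. 1 - 1 / real (Suc i) < prob A}" for i
  have large: "\<exists>n. A n \<in> \<T> i" if A: "range A \<subseteq> sets X" "incseq A" "(\<Union>n. A n) = space X" for i and A :: "nat \<Rightarrow> 'a set"
  proof -
    have "(\<lambda>n. prob (A n)) \<longlonglongrightarrow> prob (\<Union>n. A n)"
      using A by (intro finite_Lim_measure_incseq) (auto simp: sets)
    then have "(\<lambda>n. prob (A n)) \<longlonglongrightarrow> 1"
      using A(3) space prob_space by simp
    then have "\<forall>\<^sub>F n in sequentially. 1 - 1 / real (Suc i) < prob (A n)"
      by (rule order_tendstoD) simp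
    then obtain n where "1 - 1 / real (Suc i) < prob (A n)"
      by (auto simp: eventually_sequentially)
    with A(1) show ?thesis
      unfolding \<T>_def by blast
  qed
  have mono: "B \<in> \<T> i" if "A \<in> \<T> i" "A \<subseteq> B" "B \<in> sets X" for i A B
  proof -
    have "prob A \<le> prob B"
      using that by (intro finite_measure_mono) (auto simp: sets)
    with that show ?thesis
      by (simp add: \<T>_def)
  qed
  obtain B f where B: "\<forall>m::nat. B m \<in> sets X" "\<forall>m i. B m \<in> \<T> i"
    and f: "invariant_set X G (\<Inter>m. B m)" "borel_labelling X G (\<Inter>m. B m) f"
    "symmetric_labelling G (\<Inter>m. B m) f" "\<forall>v\<in>(\<Inter>m. B m). domatic_at X G f v"
    by (rule generic_domatic_labelling[OF X G reg large mono])
  have "prob (B m) = 1" for m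
  proof (rule antisym[OF prob_le_1], rule field_le_epsilon)
    fix \<epsilon> :: real assume "0 < \<epsilon>"
    then obtain i where "1 / real (Suc i) < \<epsilon>"
      using reals_Archimedean[of \<epsilon>] by (auto simp: inverse_eq_divide)
    moreover have "1 - 1 / real (Suc i) < prob (B m)"
      using B(2) by (simp add: \<T>_def)
    ultimately show "1 \<le> prob (B m) + \<epsilon>"
      by linarith
  qed
  then have "space \<mu> - B m \<in> null_sets \<mu>" for m
    using B(1) sets prob_compl[of "B m"] by (auto simp: null_sets_def emeasure_eq_measure)
  then have "(\<Union>m. space \<mu> - B m) \<in> null_sets \<mu>"
    by (rule null_sets_UN)
  moreover have "(\<Union>m. space \<mu> - B m) = space \<mu> - (\<Inter>m. B m)"
    by blast
  moreover have C: "(\<Inter>m. B m) \<in> sets X"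
    using B(1) by (intro sets.countable_INT) auto
  ultimately have "conull \<mu> (\<Inter>m. B m)"
    unfolding conull_def using sets.sets_into_space[OF C] space by simp
  with C f show ?thesis
    by blast
qed

theorem domatic_labelling_comeager:
  assumes X: "standard_borel_space X" and G: "borel_graph X G" and reg: "aleph0_regular X G"
    and \<tau>: "polish_topology_on X \<tau>"
  shows "\<exists>C f. C \<in> sets X \<and> invariant_set X G C \<and> comeager_in \<tau> C \<and> borel_labelling X G C f \<and>
    symmetric_labelling G C f \<and> (\<forall>v\<in>C. domatic_at X G f v)"
proof -
  have top: "topspace \<tau> = space X" "sets X = sigma_sets (space X) {U. openin \<tau> U}"
      "completely_metrizable_space \<tau>"
    using \<tau> unfolding polish_topology_on_def polish_topology_def by auto
  obtain V :: "nat \<Rightarrow> 'a set" where V: "\<forall>i. openin \<tau> (V i)"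
    "\<forall>U. openin \<tau> U \<and> U \<noteq> {} \<longrightarrow> (\<exists>i. V i \<noteq> {} \<and> V i \<subseteq> U)"
    by (rule polish_pi_base[OF \<tau>])
  \<comment> \<open>The guard makes the test passable when \<open>V i\<close> is empty. For nonempty
    \<open>V i\<close> an exhaustion passes it by the Baire category theorem.\<close>
  define \<T> where "\<T> i = {A. V i \<noteq> {} \<longrightarrow> \<not> meager_in \<tau> (A \<inter> V i)}" for i
  have large: "\<exists>n. A n \<in> \<T> i" if A: "range A \<subseteq> sets X" "incseq A" "(\<Union>n. A n) = space X" for i and A :: "nat \<Rightarrow> 'a set"
  proof (rule ccontr)
    assume "\<nexists>n. A n \<in> \<T> i"
    then have *: "V i \<noteq> {}" "\<And>n. meager_in \<tau> (A n \<inter> V i)"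
      by (auto simp: \<T>_def)
    have "V i \<subseteq> (\<Union>n. A n)"
      unfolding A(3) top(1)[symmetric] using V(1) by (intro openin_subset) simp
    then have "V i \<subseteq> (\<Union>n. A n \<inter> V i)"
      by blast
    with meager_in_UN[OF *(2)] have "meager_in \<tau> (V i)"
      by (rule meager_in_subset)
    then show False
      using nonempty_open_not_meager[OF top(3)] V(1) *(1) by blast
  qed
  have mono: "B \<in> \<T> i" if "A \<in> \<T> i" "A \<subseteq> B" "B \<in> sets X" for i A B
  proof -
    have "A \<inter> V i \<subseteq> B \<inter> V i"
      using that by blast
    then show ?thesis
      using that(1) meager_in_subset unfolding \<T>_def by blast
  qed
  obtain B f where B: "\<forall>m::nat. B m \<in> sets X" "\<forall>m i. B m \<in> \<T> i"
    and f: "invariant_set X G (\<Inter>m. B m)" "borel_labelling X G (\<Inter>m. B m) f"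
    "symmetric_labelling G (\<Inter>m. B m) f" "\<forall>v\<in>(\<Inter>m. B m). domatic_at X G f v"
    by (rule generic_domatic_labelling[OF X G reg large mono])
  have "meager_in \<tau> (space X - B m)" for m
  proof -
    have "space X - B m \<in> sigma_sets (topspace \<tau>) {U. openin \<tau> U}"
      using B(1) top by (metis sets.compl_sets)
    from borel_baire_property[OF this] obtain U where
      U: "openin \<tau> U" "meager_in \<tau> ((space X - B m) - U)" "meager_in \<tau> (U - (space X - B m))"
      by blast
    \<comment> \<open>\<open>U\<close> equals the complement of \<open>B m\<close> up to a meager
      set. If nonempty, it would contain a nonempty \<open>V i\<close> in which \<open>B m\<close>
      is meager, against test \<open>i\<close>.\<close>
    have "U = {}"
    proof (rule ccontr)
      assume "U \<noteq> {}"
      with V(2) U(1) obtain i where i: "V i \<noteq> {}" "V i \<subseteq> U"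
        by blast
      have "meager_in \<tau> (B m \<inter> V i)"
        by (rule meager_in_subset[OF U(3)]) (use i(2) in blast)
      moreover have "B m \<in> \<T> i"
        using B(2) by blast
      ultimately show False
        using i(1) by (simp add: \<T>_def)
    qed
    with U(2) show ?thesis
      by simp
  qed
  then have "meager_in \<tau> (\<Union>m. space X - B m)"
    by (rule meager_in_UN)
  moreover have "(\<Union>m. space X - B m) = topspace \<tau> - (\<Inter>m. B m)"
    using top(1) by blast
  moreover have C: "(\<Inter>m. B m) \<in> sets X"
    using B(1) by (intro sets.countable_INT) auto
  ultimately have "comeager_in \<tau> (\<Inter>m. B m)"
    unfolding comeager_in_def using sets.sets_into_space[OF C] top(1) by simp
  with C f show ?thesis
    by blast
qed

theorem theorem1p8:
  fixes X :: "'a measure" and G :: "('a \<times> 'a) set"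
  assumes "standard_borel_space X"
    and "borel_graph X G"
    and "aleph0_regular X G"
  shows "(\<forall>\<mu> :: 'a measure. prob_space \<mu> \<and> sets \<mu> = sets X \<longrightarrow>
           (\<exists>C f. C \<in> sets X \<and> invariant_set X G C \<and> conull \<mu> C \<and>
              borel_labelling X G C f \<and> symmetric_labelling G C f \<and>
              (\<forall>v \<in> C. domatic_at X G f v)))
       \<and> (\<forall>\<tau> :: 'a topology. polish_topology_on X \<tau> \<longrightarrow>
           (\<exists>C f. C \<in> sets X \<and> invariant_set X G C \<and> comeager_in \<tau> C \<and>
              borel_labelling X G C f \<and> symmetric_labelling G C f \<and>
              (\<forall>v \<in> C. domatic_at X G f v)))"
  using domatic_labelling_conull[OF assms] domatic_labelling_comeager[OF assms] by blast

end
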